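(* Let $(T,F)$ be a rooted tree with a sink $\ast$ over $(Q,\rho)$ and $M:=M(T,F)$. Suppose $n_1,\dots,n_k$ is the list of all the vertices of $T$ such that $\mathsf p(n_j)=\ast$, and that $M_j:=M(\mathsf{Br}(n_j),F|_{\mathsf{Br}(n_j)})$ is indecomposable for each $j$. Then the following are equivalent. (a) The module $M$ is decomposable. (b) There are distinct $i,j\in\{1,\dots,k\}$ satisfying $F(a_{n_i})=F(a_{n_j})$, and a quiver morphism $\iota:\mathsf{Br}(n_i)\to\mathsf{Br}(n_j)$ satisfying $\iota(n_i)=n_j$ and $F|_{\mathsf{Br}(n_j)}\circ\iota=F|_{\mathsf{Br}(n_i)}$.
   Context: Fix a field $\mathcal K$ with $\mathrm{char}(\mathcal K)\neq 2$. Let $Q=(Q_0,Q_1,\varsigma,\varepsilon)$ be a quiver and $\rho$ a set of paths in $Q$ of length at least $2$ that bounds the length of the paths, not lying in the ideal $\langle\rho\rangle$, passing through any vertex. Put $\Lambda:=\mathcal KQ/\langle\rho\rangle$. Finite-dimensional $\Lambda$-modules are identified with finite-dimensional $\mathcal K$-representations of $(Q,\rho)$. A tree is a finite quiver $T=(T_0,T_1,s,t)$ whose underlying undirected graph is connected without cycles. Here rooted trees have a unique sink $\ast$ (the root). For $n\in T_0\setminus\{\ast\}$ there is a unique arrow with source $n$, denoted $a_n$; its target is the parent $\mathsf p(n)$. For $n\in T_0$, the branch $\mathsf{Br}(n)$ is the subquiver of $T$ with vertices all $n'\in T_0$ admitting a (possibly zero-length) path from $n'$ to $n$, and arrows $a_m$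 for $m\in\mathsf{Br}(n)_0\setminus\{n\}$; it is a rooted tree with sink $n$. A quiver morphism is a pair of maps (on vertices and on arrows) commuting with sources and targets. A quiver morphism $F:T\to Q$ is bound, written $F:T\to(Q,\rho)$, if there is no path $p$ in $T$ with $F(p)\in\langle\rho\rangle$; then $(T,F)$ is a tree over $(Q,\rho)$. The rooted tree module $M(T,F)$ is the $\Lambda$-module with $\mathcal K$-basis $\{v_n\mid n\in T_0\}$, with $v_n$ at the vertex $F(n)$, where $\gamma\in Q_1$ acts by $\gamma\cdot v_n=\sum_{a\in T_1,\ s(a)=n,\ F(a)=\gamma}v_{t(a)}$. *)

theory Defs
  imports
    "Graph_Theory.Digraph_Component"
    "Graph_Theory.Arc_Walk"
    "HOL-Library.Poly_Mapping"
begin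

section \<open>Quivers, paths and the path algebra\<close>

text \<open>
  A quiver is a well-formed digraph in the sense of \<^locale>\<open>wf_digraph\<close>; loops, multiple arrows
  and infinitely many vertices or arrows are allowed.  A path is a pair consisting of its starting
  vertex and the list of its arrows in the order in which they are traversed, so that
  \<open>(x, [])\<close> is the path of length zero at \<open>x\<close>.
\<close>

type_synonym ('v, 'a) path = "'v \<times> 'a list"

definition paths :: "('v, 'a) pre_digraph \<Rightarrow> ('v, 'a) path set" where
  "paths Q = {p. \<exists>v. pre_digraph.awalk Q (fst p) (snd p) v}"

definition path_end :: "('v, 'a) pre_digraph \<Rightarrow> ('v, 'a) path \<Rightarrow> 'v" where
  "path_end Q p = last (pre_digraph.awalk_verts Q (fst p) (snd p))"

definition passes_through :: "('v, 'a) pre_digraph \<Rightarrow> ('v, 'a) path \<Rightarrow> 'v \<Rightarrow> bool" where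
  "passes_through Q p x \<longleftrightarrow> x \<in> set (pre_digraph.awalk_verts Q (fst p) (snd p))"

definition scale_pm :: "'k::field \<Rightarrow> ('b \<Rightarrow>\<^sub>0 'k) \<Rightarrow> ('b \<Rightarrow>\<^sub>0 'k)" where
  "scale_pm c f = Poly_Mapping.map ((*) c) f"

definition path_algebra :: "('v, 'a) pre_digraph \<Rightarrow> (('v, 'a) path \<Rightarrow>\<^sub>0 'k::field) set" where
  "path_algebra Q = {f. Poly_Mapping.keys f \<subseteq> paths Q}"

text \<open>
  The bilinear extension of the product \<open>p \<cdot> q\<close> = ``first \<open>q\<close>, then \<open>p\<close>'' of paths, which is zero
  if \<open>p\<close> does not start where \<open>q\<close> ends; this is the convention for which representations are left
  modules.  The path algebra has no unit if there are infinitely many vertices.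
\<close>

definition path_mult :: "('v, 'a) pre_digraph \<Rightarrow>
    (('v, 'a) path \<Rightarrow>\<^sub>0 'k::field) \<Rightarrow> (('v, 'a) path \<Rightarrow>\<^sub>0 'k) \<Rightarrow> (('v, 'a) path \<Rightarrow>\<^sub>0 'k)" where
  "path_mult Q f g =
     (\<Sum>p\<in>Poly_Mapping.keys f. \<Sum>q\<in>Poly_Mapping.keys g.
        if path_end Q q = fst p
        then Poly_Mapping.single (fst q, snd q @ snd p)
               (Poly_Mapping.lookup f p * Poly_Mapping.lookup g q)
        else 0)"

definition path_algebra_ideal ::
    "('v, 'a) pre_digraph \<Rightarrow> (('v, 'a) path \<Rightarrow>\<^sub>0 'k::field) set \<Rightarrow> bool" where
  "path_algebra_ideal Q I \<longleftrightarrow>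
     I \<subseteq> path_algebra Q \<and> module.subspace scale_pm I \<and>
     (\<forall>f\<in>path_algebra Q. \<forall>g\<in>I. path_mult Q f g \<in> I \<and> path_mult Q g f \<in> I)"

definition relation_ideal ::
    "('v, 'a) pre_digraph \<Rightarrow> ('v, 'a) path set \<Rightarrow> (('v, 'a) path \<Rightarrow>\<^sub>0 'k::field) set" where
  "relation_ideal Q \<rho> =
     path_algebra_ideal Q hull ((\<lambda>p. Poly_Mapping.single p 1) ` \<rho>)"

abbreviation path_in_ideal ::
    "'k::field itself \<Rightarrow> ('v, 'a) pre_digraph \<Rightarrow> ('v, 'a) path set \<Rightarrow> ('v, 'a) path \<Rightarrow> bool" where
  "path_in_ideal K Q \<rho> p \<equiv>
     Poly_Mapping.single p 1 \<in> (relation_ideal Q \<rho> :: (('v, 'a) path \<Rightarrow>\<^sub>0 'k) set)"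

text \<open>The bound on the lengths may depend on the vertex.\<close>

definition bound_quiver ::
    "'k::field itself \<Rightarrow> ('v, 'a) pre_digraph \<Rightarrow> ('v, 'a) path set \<Rightarrow> bool" where
  "bound_quiver K Q \<rho> \<longleftrightarrow>
     wf_digraph Q \<and>
     \<rho> \<subseteq> paths Q \<and> (\<forall>p\<in>\<rho>. 2 \<le> length (snd p)) \<and>
     (\<forall>x\<in>verts Q. \<exists>N. \<forall>p\<in>paths Q.
        passes_through Q p x \<and> \<not> path_in_ideal K Q \<rho> p \<longrightarrow> length (snd p) \<le> N)"

section \<open>Representations of bound quivers\<close>

text \<open>
  The vector spaces at the vertices are subspaces of one ambient vector space with scalar
  multiplication \<open>smult\<close>; \<open>act \<gamma>\<close> is relevant only on the space at the source of \<open>\<gamma>\<close>.  The total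
  space of the module corresponding to the representation is the external direct sum of
  the spaces at the vertices, so spaces at different vertices may overlap in the ambient space.
\<close>

record ('v, 'a, 'k, 'm) quiver_rep =
  smult :: "'k \<Rightarrow> 'm \<Rightarrow> 'm"
  space :: "'v \<Rightarrow> 'm set"
  act :: "'a \<Rightarrow> 'm \<Rightarrow> 'm"

locale fd_rep =
  fixes Q :: "('v, 'a) pre_digraph" and \<rho> :: "('v, 'a) path set"
    and M :: "('v, 'a, 'k::field, 'm::ab_group_add) quiver_rep"
  assumes ambient: "vector_space (smult M)"
    and subspace: "x \<in> verts Q \<Longrightarrow> module.subspace (smult M) (space M x)"
    and act_closed: "\<gamma> \<in> arcs Q \<Longrightarrow> v \<in> space M (tail Q \<gamma>) \<Longrightarrow> act M \<gamma> v \<in> space M (head Q \<gamma>)"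
    and act_add: "\<gamma> \<in> arcs Q \<Longrightarrow> v \<in> space M (tail Q \<gamma>) \<Longrightarrow> w \<in> space M (tail Q \<gamma>) \<Longrightarrow>
      act M \<gamma> (v + w) = act M \<gamma> v + act M \<gamma> w"
    and act_smult: "\<gamma> \<in> arcs Q \<Longrightarrow> v \<in> space M (tail Q \<gamma>) \<Longrightarrow>
      act M \<gamma> (smult M c v) = smult M c (act M \<gamma> v)"
    and relations: "p \<in> \<rho> \<Longrightarrow> v \<in> space M (fst p) \<Longrightarrow> fold (act M) (snd p) v = 0"
    and finite_support: "finite {x \<in> verts Q. space M x \<noteq> {0}}"
    and finite_dim: "x \<in> verts Q \<Longrightarrow> \<exists>B. finite B \<and> space M x \<subseteq> module.span (smult M) B"

definition nonzero_rep :: "('v, 'a) pre_digraph \<Rightarrow> ('v, 'a, 'k, 'm::zero) quiver_rep \<Rightarrow> bool" where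
  "nonzero_rep Q M \<longleftrightarrow> (\<exists>x\<in>verts Q. space M x \<noteq> {0})"

definition subrep :: "('v, 'a) pre_digraph \<Rightarrow> ('v, 'a) path set \<Rightarrow>
    ('v, 'a, 'k::field, 'm::ab_group_add) quiver_rep \<Rightarrow> ('v, 'a, 'k, 'm) quiver_rep \<Rightarrow> bool" where
  "subrep Q \<rho> U M \<longleftrightarrow>
     fd_rep Q \<rho> U \<and> smult U = smult M \<and> (\<forall>x\<in>verts Q. space U x \<subseteq> space M x) \<and>
     (\<forall>\<gamma>\<in>arcs Q. \<forall>v\<in>space U (tail Q \<gamma>). act U \<gamma> v = act M \<gamma> v)"

definition direct_sum_of :: "('v, 'a) pre_digraph \<Rightarrow> ('v, 'a) path set \<Rightarrow>
    ('v, 'a, 'k::field, 'm::ab_group_add) quiver_rep \<Rightarrow>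
    ('v, 'a, 'k, 'm) quiver_rep \<Rightarrow> ('v, 'a, 'k, 'm) quiver_rep \<Rightarrow> bool" where
  "direct_sum_of Q \<rho> M U W \<longleftrightarrow>
     subrep Q \<rho> U M \<and> subrep Q \<rho> W M \<and>
     (\<forall>x\<in>verts Q. space M x = {u + w | u w. u \<in> space U x \<and> w \<in> space W x} \<and>
        space U x \<inter> space W x = {0})"

definition decomposable :: "('v, 'a) pre_digraph \<Rightarrow> ('v, 'a) path set \<Rightarrow>
    ('v, 'a, 'k::field, 'm::ab_group_add) quiver_rep \<Rightarrow> bool" where
  "decomposable Q \<rho> M \<longleftrightarrow>
     (\<exists>U W. direct_sum_of Q \<rho> M U W \<and> nonzero_rep Q U \<and> nonzero_rep Q W)"

definition indecomposable :: "('v, 'a) pre_digraph \<Rightarrow> ('v, 'a) path set \<Rightarrow>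
    ('v, 'a, 'k::field, 'm::ab_group_add) quiver_rep \<Rightarrow> bool" where
  "indecomposable Q \<rho> M \<longleftrightarrow> fd_rep Q \<rho> M \<and> nonzero_rep Q M \<and> \<not> decomposable Q \<rho> M"

section \<open>Quiver morphisms\<close>

record ('v, 'a, 'w, 'b) quiver_map =
  vmap :: "'v \<Rightarrow> 'w"
  amap :: "'a \<Rightarrow> 'b"

definition quiver_morphism :: "('v, 'a) pre_digraph \<Rightarrow> ('w, 'b) pre_digraph \<Rightarrow>
    ('v, 'a, 'w, 'b) quiver_map \<Rightarrow> bool" where
  "quiver_morphism G H F \<longleftrightarrow>
     vmap F ` verts G \<subseteq> verts H \<and> amap F ` arcs G \<subseteq> arcs H \<and>
     (\<forall>a\<in>arcs G. tail H (amap F a) = vmap F (tail G a) \<and> head H (amap F a) = vmap F (head G a))"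

definition quiver_map_comp :: "('w, 'b, 'u, 'c) quiver_map \<Rightarrow> ('v, 'a, 'w, 'b) quiver_map \<Rightarrow>
    ('v, 'a, 'u, 'c) quiver_map" where
  "quiver_map_comp F G = \<lparr>vmap = vmap F \<circ> vmap G, amap = amap F \<circ> amap G\<rparr>"

text \<open>
  Equality of quiver morphisms with source \<open>G\<close>.  Since morphisms are total functions of the
  underlying types, the restriction of a morphism to a subquiver is the same \<open>quiver_map\<close>.
\<close>

definition quiver_map_eq_on :: "('v, 'a) pre_digraph \<Rightarrow> ('v, 'a, 'w, 'b) quiver_map \<Rightarrow>
    ('v, 'a, 'w, 'b) quiver_map \<Rightarrow> bool" where
  "quiver_map_eq_on G F F' \<longleftrightarrow>
     (\<forall>x\<in>verts G. vmap F x = vmap F' x) \<and> (\<forall>a\<in>arcs G. amap F a = amap F' a)"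

definition path_image :: "('v, 'a, 'w, 'b) quiver_map \<Rightarrow> ('v, 'a) path \<Rightarrow> ('w, 'b) path" where
  "path_image F p = (vmap F (fst p), map (amap F) (snd p))"

definition bound_morphism :: "'k::field itself \<Rightarrow> ('n, 'e) pre_digraph \<Rightarrow>
    ('v, 'a) pre_digraph \<Rightarrow> ('v, 'a) path set \<Rightarrow> ('n, 'e, 'v, 'a) quiver_map \<Rightarrow> bool" where
  "bound_morphism K T Q \<rho> F \<longleftrightarrow>
     quiver_morphism T Q F \<and> \<not> (\<exists>p\<in>paths T. path_in_ideal K Q \<rho> (path_image F p))"

section \<open>Rooted trees\<close>

text \<open>
  The double quiver has an arrow \<open>(a, True)\<close> parallel and an arrow \<open>(a, False)\<close> opposite to every
  arrow \<open>a\<close>, so that its walks are the walks of the underlying undirected (multi)graph.  The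
  constants \<^const>\<open>forest\<close> and \<^const>\<open>tree\<close> of Graph\_Theory only exclude directed cycles.
\<close>

definition double_quiver :: "('n, 'e) pre_digraph \<Rightarrow> ('n, 'e \<times> bool) pre_digraph" where
  "double_quiver T = \<lparr>verts = verts T, arcs = arcs T \<times> UNIV,
     tail = (\<lambda>(a, d). if d then tail T a else head T a),
     head = (\<lambda>(a, d). if d then head T a else tail T a)\<rparr>"

text \<open>Loops and pairs of parallel or antiparallel arrows are undirected cycles.\<close>

definition undirected_cycle :: "('n, 'e) pre_digraph \<Rightarrow> ('e \<times> bool) list \<Rightarrow> bool" where
  "undirected_cycle T c \<longleftrightarrow> pre_digraph.cycle (double_quiver T) c \<and> distinct (map fst c)"

definition quiver_tree :: "('n, 'e) pre_digraph \<Rightarrow> bool" where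
  "quiver_tree T \<longleftrightarrow> fin_digraph T \<and> connected T \<and> \<not> (\<exists>c. undirected_cycle T c)"

definition rooted_tree :: "('n, 'e) pre_digraph \<Rightarrow> 'n \<Rightarrow> bool" where
  "rooted_tree T r \<longleftrightarrow> quiver_tree T \<and> {n \<in> verts T. out_arcs T n = {}} = {r}"

text \<open>The following two are meaningful only for vertices other than the root.\<close>

definition out_arrow :: "('n, 'e) pre_digraph \<Rightarrow> 'n \<Rightarrow> 'e" where
  "out_arrow T n = (THE a. a \<in> arcs T \<and> tail T a = n)"

definition parent :: "('n, 'e) pre_digraph \<Rightarrow> 'n \<Rightarrow> 'n" where
  "parent T n = head T (out_arrow T n)"

definition branch :: "('n, 'e) pre_digraph \<Rightarrow> 'n \<Rightarrow> ('n, 'e) pre_digraph" where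
  "branch T n = (let V = {m \<in> verts T. m \<rightarrow>\<^sup>*\<^bsub>T\<^esub> n} in
     \<lparr>verts = V, arcs = out_arrow T ` (V - {n}), tail = tail T, head = head T\<rparr>)"

section \<open>Rooted tree modules\<close>

text \<open>The basis vector \<open>v\<^sub>n\<close>, in the vector space of finitely supported functions.\<close>

abbreviation basis_vec :: "'n \<Rightarrow> ('n \<Rightarrow>\<^sub>0 'k::field)" where
  "basis_vec n \<equiv> Poly_Mapping.single n 1"

definition tree_module :: "('n, 'e) pre_digraph \<Rightarrow> ('n, 'e, 'v, 'a) quiver_map \<Rightarrow>
    ('v, 'a, 'k::field, 'n \<Rightarrow>\<^sub>0 'k) quiver_rep" where
  "tree_module T F =
     \<lparr>smult = scale_pm,
      space = (\<lambda>x. module.span scale_pm {basis_vec n | n. n \<in> verts T \<and> vmap F n = x}),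
      act = (\<lambda>\<gamma> f. \<Sum>n\<in>Poly_Mapping.keys f. scale_pm (Poly_Mapping.lookup f n)
               (\<Sum>a | a \<in> arcs T \<and> tail T a = n \<and> amap F a = \<gamma>. basis_vec (head T a)))\<rparr>"

subsection \<open>Rooted tree modules are finite-dimensional representations of the bound quiver\<close>

lemma lookup_scale_pm: "Poly_Mapping.lookup (scale_pm c f) x = c * Poly_Mapping.lookup f x"
  by (simp add: scale_pm_def Poly_Mapping.map.rep_eq when_def)

lemma vector_space_scale_pm: "vector_space (scale_pm :: 'k::field \<Rightarrow> _)"
  by unfold_locales (auto intro!: poly_mapping_eqI simp: lookup_scale_pm lookup_add algebra_simps)

interpretation pm: vector_space "scale_pm :: 'k::field \<Rightarrow> ('b \<Rightarrow>\<^sub>0 'k) \<Rightarrow> ('b \<Rightarrow>\<^sub>0 'k)"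
  by (rule vector_space_scale_pm)

lemma act_tree_module:
  assumes "finite S" "Poly_Mapping.keys f \<subseteq> S"
  shows "act (tree_module T F) \<gamma> f = (\<Sum>n\<in>S. scale_pm (Poly_Mapping.lookup f n)
           (\<Sum>a | a \<in> arcs T \<and> tail T a = n \<and> amap F a = \<gamma>. basis_vec (head T a)))"
  unfolding tree_module_def quiver_rep.simps using assms
  by (intro sum.mono_neutral_left) (auto simp: in_keys_iff)

lemma keys_space_tree_module:
  assumes "f \<in> space (tree_module T F :: ('v, 'a, 'k::field, 'n \<Rightarrow>\<^sub>0 'k) quiver_rep) x"
  shows "Poly_Mapping.keys f \<subseteq> {n \<in> verts T. vmap F n = x}"
proof -
  have f: "f \<in> pm.span {basis_vec n | n. n \<in> verts T \<and> vmap F n = x}"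
    using assms by (simp add: tree_module_def)
  have sub: "pm.subspace {f :: 'n \<Rightarrow>\<^sub>0 'k. Poly_Mapping.keys f \<subseteq> {n \<in> verts T. vmap F n = x}}"
    unfolding pm.subspace_def by (auto simp: subset_eq in_keys_iff lookup_scale_pm lookup_add)
  have "pm.span {basis_vec n | n. n \<in> verts T \<and> vmap F n = x}
      \<subseteq> {f :: 'n \<Rightarrow>\<^sub>0 'k. Poly_Mapping.keys f \<subseteq> {n \<in> verts T. vmap F n = x}}"
    by (rule pm.span_minimal[OF _ sub]) auto
  then show ?thesis using f by blast
qed

lemma keys_act_tree_module:
  "Poly_Mapping.keys (act (tree_module T F) \<gamma> f)
     \<subseteq> {head T a | a. a \<in> arcs T \<and> tail T a \<in> Poly_Mapping.keys f \<and> amap F a = \<gamma>}"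
proof
  fix m assume "m \<in> Poly_Mapping.keys (act (tree_module T F) \<gamma> f)"
  then have "(\<Sum>n\<in>Poly_Mapping.keys f. Poly_Mapping.lookup f n *
      (\<Sum>a | a \<in> arcs T \<and> tail T a = n \<and> amap F a = \<gamma>.
        Poly_Mapping.lookup (basis_vec (head T a)) m)) \<noteq> 0"
    by (simp add: tree_module_def in_keys_iff lookup_sum lookup_scale_pm)
  then obtain n where n: "n \<in> Poly_Mapping.keys f"
    and "Poly_Mapping.lookup f n * (\<Sum>a | a \<in> arcs T \<and> tail T a = n \<and> amap F a = \<gamma>.
        Poly_Mapping.lookup (basis_vec (head T a)) m) \<noteq> 0"
    by (rule sum.not_neutral_contains_not_neutral)
  then have "(\<Sum>a | a \<in> arcs T \<and> tail T a = n \<and> amap F a = \<gamma>.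
        Poly_Mapping.lookup (basis_vec (head T a) :: _ \<Rightarrow>\<^sub>0 'b) m) \<noteq> 0"
    by auto
  then obtain a where "a \<in> {a. a \<in> arcs T \<and> tail T a = n \<and> amap F a = \<gamma>}"
    and "Poly_Mapping.lookup (basis_vec (head T a) :: _ \<Rightarrow>\<^sub>0 'b) m \<noteq> 0"
    by (rule sum.not_neutral_contains_not_neutral)
  then show "m \<in> {head T a | a. a \<in> arcs T \<and> tail T a \<in> Poly_Mapping.keys f \<and> amap F a = \<gamma>}"
    using n by (auto simp: lookup_single when_def split: if_splits)
qed

lemma fold_act_tree_module_eq_0:
  assumes "wf_digraph T" "Poly_Mapping.keys f \<subseteq> verts T"
    and "\<And>n q w. n \<in> Poly_Mapping.keys f \<Longrightarrow> pre_digraph.awalk T n q w \<Longrightarrow> map (amap F) q \<noteq> p"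
  shows "fold (act (tree_module T F)) p f = 0"
  using assms(2,3)
proof (induction p arbitrary: f)
  case Nil
  have "pre_digraph.awalk T n [] n" if "n \<in> Poly_Mapping.keys f" for n
    using that Nil.prems(1) by (auto simp: pre_digraph.awalk_def pre_digraph.cas.simps)
  then have "Poly_Mapping.keys f = {}" using Nil.prems(2) by fastforce
  then show ?case by simp
next
  case (Cons \<gamma> p)
  interpret wf_digraph T by fact
  have "fold (act (tree_module T F)) p (act (tree_module T F) \<gamma> f) = 0"
  proof (rule Cons.IH)
    show "Poly_Mapping.keys (act (tree_module T F) \<gamma> f) \<subseteq> verts T"
      using keys_act_tree_module[of T F \<gamma> f] by auto
    fix n q w
    assume n: "n \<in> Poly_Mapping.keys (act (tree_module T F) \<gamma> f)" and q: "awalk n q w"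
    obtain a where a: "a \<in> arcs T" "tail T a \<in> Poly_Mapping.keys f" "amap F a = \<gamma>" "n = head T a"
      using keys_act_tree_module[of T F \<gamma> f] n by auto
    have "awalk (tail T a) (a # q) w" using a q by (auto simp: awalk_def)
    then have "map (amap F) (a # q) \<noteq> \<gamma> # p" by (rule Cons.prems(2)[OF a(2)])
    then show "map (amap F) q \<noteq> p" using a(3) by simp
  qed
  then show ?case by simp
qed

theorem fd_rep_tree_module:
  fixes F :: "('n, 'e, 'v, 'a) quiver_map"
  assumes \<rho>: "\<rho> \<subseteq> paths Q" and T: "fin_digraph T"
    and F: "bound_morphism TYPE('k::field) T Q \<rho> F"
  shows "fd_rep Q \<rho> (tree_module T F :: ('v, 'a, 'k, 'n \<Rightarrow>\<^sub>0 'k) quiver_rep)"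
proof -
  interpret fin_digraph T by fact
  let ?M = "tree_module T F :: ('v, 'a, 'k, 'n \<Rightarrow>\<^sub>0 'k) quiver_rep"
  let ?B = "\<lambda>x. {basis_vec n :: 'n \<Rightarrow>\<^sub>0 'k | n. n \<in> verts T \<and> vmap F n = x}"
  have smult: "smult ?M = scale_pm" and space: "\<And>x. space ?M x = pm.span (?B x)"
    by (simp_all add: tree_module_def)
  have mor: "quiver_morphism T Q F" using F by (simp add: bound_morphism_def)
  show ?thesis
  proof (rule fd_rep.intro, unfold smult)
    fix x show "pm.subspace (space ?M x)" by (simp add: space)
  next
    fix \<gamma> and v :: "'n \<Rightarrow>\<^sub>0 'k"
    show "act ?M \<gamma> v \<in> space ?M (head Q \<gamma>)"
      unfolding space tree_module_def quiver_rep.simps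
    proof (intro pm.span_sum pm.span_scale pm.span_base)
      fix n a assume "a \<in> {a \<in> arcs T. tail T a = n \<and> amap F a = \<gamma>}"
      then show "basis_vec (head T a) \<in> ?B (head Q \<gamma>)"
        using mor by (auto simp: quiver_morphism_def)
    qed
  next
    fix \<gamma> and v w :: "'n \<Rightarrow>\<^sub>0 'k"
    let ?S = "Poly_Mapping.keys v \<union> Poly_Mapping.keys w"
    have "Poly_Mapping.keys (v + w) \<subseteq> ?S" by (rule Poly_Mapping.keys_add)
    then show "act ?M \<gamma> (v + w) = act ?M \<gamma> v + act ?M \<gamma> w"
      by (simp add: act_tree_module[where S = ?S] lookup_add pm.scale_left_distrib sum.distrib)
  next
    fix \<gamma> c and v :: "'n \<Rightarrow>\<^sub>0 'k"
    have "Poly_Mapping.keys (scale_pm c v) \<subseteq> Poly_Mapping.keys v"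
      by (auto simp: in_keys_iff lookup_scale_pm)
    then show "act ?M \<gamma> (scale_pm c v) = scale_pm c (act ?M \<gamma> v)"
      by (simp add: act_tree_module[where S = "Poly_Mapping.keys v"] lookup_scale_pm
          pm.scale_sum_right)
  next
    fix p and v :: "'n \<Rightarrow>\<^sub>0 'k" assume p: "p \<in> \<rho>" and v: "v \<in> space ?M (fst p)"
    have p_in: "path_in_ideal TYPE('k) Q \<rho> p"
      unfolding relation_ideal_def by (rule hull_inc) (use p in auto)
    show "fold (act ?M) (snd p) v = 0"
    proof (rule fold_act_tree_module_eq_0)
      fix n q w assume n: "n \<in> Poly_Mapping.keys v" and q: "awalk n q w"
      then have "vmap F n = fst p" using keys_space_tree_module[OF v] by auto
      moreover have "(n, q) \<in> paths T" using q by (auto simp: paths_def)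
      moreover have "path_image F (n, q) \<noteq> p"
        using F p_in \<open>(n, q) \<in> paths T\<close> unfolding bound_morphism_def by blast
      ultimately show "map (amap F) q \<noteq> snd p"
        unfolding path_image_def by (metis fst_conv snd_conv prod.collapse)
    qed (use keys_space_tree_module[OF v] wf_digraph in auto)
  next
    have "{x \<in> verts Q. space ?M x \<noteq> {0}} \<subseteq> vmap F ` verts T"
    proof
      fix x assume x: "x \<in> {x \<in> verts Q. space ?M x \<noteq> {0}}"
      then have "?B x \<noteq> {}" unfolding space using pm.span_empty by force
      then show "x \<in> vmap F ` verts T" by auto
    qed
    then show "finite {x \<in> verts Q. space ?M x \<noteq> {0}}" by (rule finite_subset) simp
  next
    fix x show "\<exists>B. finite B \<and> space ?M x \<subseteq> pm.span B"
      by (rule exI[of _ "?B x"]) (simp add: space)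
  qed (rule vector_space_scale_pm)
qed

end

theory Submission
  imports Defs
begin

text \<open>
  A morphism \<open>\<iota>\<close> between the branches at two siblings whose arrows to their parent have the same label
  yields the idempotent endomorphism that maps \<open>v\<^sub>y\<close> to \<open>v\<^sub>y - v\<^bsub>\<iota> y\<^esub>\<close> on the first branch and is zero
  elsewhere; hence a tree module is decomposable as soon as there are such siblings anywhere in the
  tree.

  Conversely, suppose that there are no such siblings.  For a splitting of the module into \<open>U\<close> and
  \<open>W\<close> let \<open>u\<^sub>n\<close> be the \<open>U\<close>-component of \<open>v\<^sub>n\<close>.  If \<open>v\<^sub>m\<close> occurs in \<open>u\<^sub>n\<close>, then \<open>n \<mapsto> m\<close> extends to a
  morphism of branches.  Hence the component at the root is a multiple of the root vector, and after
  exchanging \<open>U\<close> and \<open>W\<close> if necessary it is zero.  The relation ``\<open>v\<^sub>m\<close> occurs in \<open>u\<^sub>n\<close>'' is then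
  acyclic: applying an arrow cannot cancel the coefficients along a cycle, so the parents of a cycle
  form a cycle again, and climbing ends at the root.  The projection onto \<open>U\<close> is therefore nilpotent
  as well as idempotent, so \<open>U = 0\<close>.
\<close>

section \<open>Rooted trees\<close>

text \<open>The directed form of a rooted tree. Arguments about parents and directed walks need only
  these properties, and a branch inherits them without any mention of undirected cycles.\<close>

locale in_tree = fin_digraph T for T :: "('n, 'e) pre_digraph" (structure) +
  fixes r :: 'n
  assumes acyclic_ends: "acyclic (arcs_ends T)"
    and unique_out: "a \<in> arcs T \<Longrightarrow> b \<in> arcs T \<Longrightarrow> tail T a = tail T b \<Longrightarrow> a = b"
    and root_in_verts: "r \<in> verts T"
    and tail_neq_root: "a \<in> arcs T \<Longrightarrow> tail T a \<noteq> r"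
    and out_ex: "n \<in> verts T \<Longrightarrow> n \<noteq> r \<Longrightarrow> \<exists>a\<in>arcs T. tail T a = n"

section \<open>Directed walks and undirected cycles\<close>

lemma (in wf_digraph) acyclic_arcs_ends_iff: "acyclic (arcs_ends G) \<longleftrightarrow> (\<nexists>p. closed_w p)"
  by (auto simp: acyclic_def reachable1_awalk closed_w_def)

lemma wf_digraph_double_quiver: "wf_digraph T \<Longrightarrow> wf_digraph (double_quiver T)"
  by (auto simp: wf_digraph_def double_quiver_def)

lemma awalk_double_quiver_forward:
  assumes "wf_digraph T" "pre_digraph.awalk T u p v"
  shows "pre_digraph.awalk (double_quiver T) u (map (\<lambda>a. (a, True)) p) v"
proof -
  interpret wf_digraph T by fact
  interpret D: wf_digraph "double_quiver T" by (rule wf_digraph_double_quiver) fact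
  show ?thesis using assms(2)
    by (induction p arbitrary: u)
      (auto simp: awalk_Nil_iff awalk_Cons_iff D.awalk_Nil_iff D.awalk_Cons_iff, auto simp: double_quiver_def)
qed

lemma awalk_double_quiver_backward:
  assumes "wf_digraph T" "pre_digraph.awalk T u p v"
  shows "pre_digraph.awalk (double_quiver T) v (rev (map (\<lambda>a. (a, False)) p)) u"
proof -
  interpret wf_digraph T by fact
  interpret D: wf_digraph "double_quiver T" by (rule wf_digraph_double_quiver) fact
  show ?thesis using assms(2)
  proof (induction p arbitrary: u)
    case Nil
    moreover have "verts (double_quiver T) = verts T" by (simp add: double_quiver_def)
    ultimately show ?case by (auto simp: awalk_Nil_iff D.awalk_Nil_iff)
  next
    case (Cons a p)
    then have "D.awalk v (rev (map (\<lambda>a. (a, False)) p)) (head T a)" "a \<in> arcs T" "u = tail T a"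
      by (auto simp: awalk_Cons_iff)
    moreover from this have "D.awalk (head T a) [(a, False)] u"
      by (auto simp: D.awalk_Nil_iff D.awalk_Cons_iff) (auto simp: double_quiver_def)
    ultimately show ?case by auto
  qed
qed

text \<open>If a vertex is repeated, then the walk without its first arrow contains a closed walk,
  which is shorter and still has distinct underlying arrows.\<close>

lemma undirected_cycle_if_closed_walk:
  assumes "wf_digraph T" "pre_digraph.awalk (double_quiver T) u p u" "p \<noteq> []" "distinct (map fst p)"
  shows "\<exists>c. undirected_cycle T c"
  using assms(2-)
proof (induction "length p" arbitrary: p u rule: less_induct)
  case less
  interpret D: wf_digraph "double_quiver T" by (rule wf_digraph_double_quiver) fact
  show ?case
  proof (cases "distinct (tl (D.awalk_verts u p))")
    case True
    then have "undirected_cycle T p" using less.prems by (auto simp: undirected_cycle_def D.cycle_def)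
    then show ?thesis ..
  next
    case False
    obtain e es where p: "p = e # es" using less.prems by (cases p) auto
    have *: "D.awalk (head (double_quiver T) e) es u"
      "\<not> distinct (D.awalk_verts (head (double_quiver T) e) es)"
      using False less.prems by (auto simp: p D.awalk_Cons_iff)
    obtain q s t where "es = q @ s @ t" "D.closed_w s"
      using D.awalk_not_distinct_decomp[OF *] by (auto simp: D.closed_w_def)
    then show ?thesis using less.hyps[of s] less.prems p by (auto simp: D.closed_w_def)
  qed
qed

text \<open>
  Two directed walks with a common start and a common end that begin with different arrows; a
  shortest such pair has no arrow in common, so its union is a closed undirected walk.
\<close>

lemma undirected_cycle_if_two_walks:
  assumes T: "wf_digraph T" and no_closed: "\<nexists>p. wf_digraph.closed_w T p"
    and p: "pre_digraph.awalk T u p v" and q: "pre_digraph.awalk T u q v"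
    and ne: "p \<noteq> []" "q \<noteq> []" "hd p \<noteq> hd q"
  shows "\<exists>c. undirected_cycle T c"
  using p q ne
proof (induction "length p + length q" arbitrary: p q v rule: less_induct)
  case less
  interpret wf_digraph T by fact
  interpret D: wf_digraph "double_quiver T" by (rule wf_digraph_double_quiver) fact
  have dist: "distinct p'" if "awalk u p' w" for p' w
  proof -
    have "distinct (awalk_verts u p')"
      using awalk_not_distinct_decomp[OF that] no_closed by (auto simp: closed_w_def)
    then show ?thesis using distinct_verts_imp_distinct that by blast
  qed
  show ?case
  proof (cases "set p \<inter> set q = {}")
    case True
    let ?c = "map (\<lambda>a. (a, True)) p @ rev (map (\<lambda>a. (a, False)) q)"
    have "D.awalk u ?c u"
      using awalk_double_quiver_forward[OF T less.prems(1)] awalk_double_quiver_backward[OF T less.prems(2)]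
      by auto
    moreover have "distinct (map fst ?c)"
      using True dist[OF less.prems(1)] dist[OF less.prems(2)] by (simp add: comp_def rev_map[symmetric])
    ultimately show ?thesis using less.prems(3) undirected_cycle_if_closed_walk[OF T, of u ?c] by blast
  next
    case False
    then obtain c p1 p2 q1 q2 where pq: "p = p1 @ c # p2" "q = q1 @ c # q2"
      by (metis disjoint_iff split_list)
    have w: "awalk u p1 (tail T c)" "awalk u q1 (tail T c)"
      using less.prems(1,2) by (auto simp: pq awalk_Cons_iff)
    have nc: "s = []" if "awalk u s u" for s
      using no_closed that by (auto simp: closed_w_def)
    show ?thesis
    proof (cases "p1 = [] \<or> q1 = []")
      case True
      \<comment> \<open>If \<open>c\<close> is the first arrow of one walk, the prefix of the other
        walk before \<open>c\<close> is closed, hence empty. Both walks would then begin with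
        \<open>c\<close>.\<close>
      then have "tail T c = u" using w by (auto simp: awalk_Nil_iff)
      then have "p1 = []" "q1 = []" using w nc by auto
      then show ?thesis using less.prems pq by simp
    next
      case False
      then show ?thesis using less.hyps[OF _ w] less.prems pq by auto
    qed
  qed
qed

text \<open>Induction starting at the root: a finite acyclic relation has a well-founded converse.
  Points without outgoing arrows, in particular those outside the tree, are base cases.\<close>

lemma wf_induct_out:
  fixes P :: "'n \<Rightarrow> bool"
  assumes "fin_digraph T" "acyclic (arcs_ends T)"
    and "\<And>n. (\<And>a. a \<in> arcs T \<Longrightarrow> tail T a = n \<Longrightarrow> P (head T a)) \<Longrightarrow> P n"
  shows "P n"
proof -
  interpret fin_digraph T by fact
  have "finite (arcs_ends T)" by (simp add: arcs_ends_def)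
  then have "wf ((arcs_ends T)\<inverse>)" using assms(2) by (rule finite_acyclic_wf_converse)
  then show ?thesis
  proof (induction n rule: wf_induct_rule)
    case (less n)
    show ?case by (rule assms(3), rule less) (auto simp: arcs_ends_def arc_to_ends_def)
  qed
qed

text \<open>A directed cycle would be an undirected one. As the root is the only sink, every vertex
  then has a walk to the root. Two arrows leaving one vertex would therefore extend to two walks to
  the root with different first arrows, which produces an undirected cycle.\<close>

theorem rooted_tree_imp_in_tree:
  assumes "rooted_tree T r"
  shows "in_tree T r"
proof -
  interpret fin_digraph T using assms by (simp add: rooted_tree_def quiver_tree_def)
  have T: "wf_digraph T" ..
  have no_cyc: "\<nexists>c. undirected_cycle T c" and r: "{n \<in> verts T. out_arcs T n = {}} = {r}"
    using assms by (simp_all add: rooted_tree_def quiver_tree_def)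
  have no_closed: "\<nexists>p. closed_w p"
  proof
    assume "\<exists>p. closed_w p"
    then obtain c u where c: "awalk u c u" "c \<noteq> []" "distinct (tl (awalk_verts u c))"
      using closed_w_imp_cycle unfolding cycle_def by blast
    have "distinct (map fst (map (\<lambda>a. (a, True)) c))"
      using distinct_tl_verts_imp_distinct[OF c(1,3)] by (simp add: comp_def)
    then show False
      using undirected_cycle_if_closed_walk[OF T awalk_double_quiver_forward[OF T c(1)]] c no_cyc by simp
  qed
  have acyc: "acyclic (arcs_ends T)"
    using no_closed by (simp add: acyclic_arcs_ends_iff)
  have out: "\<exists>a\<in>arcs T. tail T a = n" if "n \<in> verts T" "n \<noteq> r" for n
    using that r by (auto simp: out_arcs_def)
  have to_root: "n \<in> verts T \<longrightarrow> (\<exists>p. awalk n p r)" for n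
  proof (induction n rule: wf_induct_out[OF fin_digraph_axioms acyc])
    case (1 n)
    show ?case
    proof (cases "n = r")
      case True
      then show ?thesis using awalk_Nil_iff by blast
    next
      case False
      show ?thesis
      proof
        assume "n \<in> verts T"
        then obtain a where "a \<in> arcs T" "tail T a = n" using out False by blast
        then show "\<exists>p. awalk n p r" using 1 awalk_Cons_iff by (metis head_in_verts)
      qed
    qed
  qed
  show ?thesis
  proof unfold_locales
    fix a b assume a: "a \<in> arcs T" and b: "b \<in> arcs T" and eq: "tail T a = tail T b"
    obtain p q where p: "awalk (head T a) p r" and q: "awalk (head T b) q r"
      using to_root a b by (meson head_in_verts)
    show "a = b"
    proof (rule ccontr)
      assume "a \<noteq> b"
      then have "\<exists>c. undirected_cycle T c"
        using a b eq p q
        by (intro undirected_cycle_if_two_walks[OF T no_closed, of "tail T a" "a # p" r "b # q"])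
          (auto simp: awalk_Cons_iff)
      then show False using no_cyc by blast
    qed
  qed (use r acyc out in \<open>auto simp: out_arcs_def\<close>)
qed

section \<open>Branches\<close>

context in_tree begin

lemma reachable_via_head:
  assumes "x \<rightarrow>\<^sup>* n" "x \<noteq> n"
  obtains a where "a \<in> arcs T" "tail T a = x" "head T a \<rightarrow>\<^sup>* n"
  using assms by (cases rule: converse_reachable_cases) auto

lemma head_reachable:
  assumes "a \<in> arcs T" "tail T a \<rightarrow>\<^sup>* n" "tail T a \<noteq> n"
  shows "head T a \<rightarrow>\<^sup>* n"
  using reachable_via_head[OF assms(2,3)] unique_out assms(1) by metis

lemma tail_reachable: "a \<in> arcs T \<Longrightarrow> head T a \<rightarrow>\<^sup>* n \<Longrightarrow> tail T a \<rightarrow>\<^sup>* n"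
  by (meson adj_reachable_trans in_arcs_imp_in_arcs_ends)

lemma not_head_reachable_tail: "a \<in> arcs T \<Longrightarrow> \<not> head T a \<rightarrow>\<^sup>* tail T a"
  using acyclic_ends in_arcs_imp_in_arcs_ends reachable_rtranclI
  unfolding acyclic_def by (metis rtrancl_into_trancl2)

lemma single_valued_ends: "single_valued (arcs_ends T)"
  using unique_out by (auto simp: single_valued_def arcs_ends_def arc_to_ends_def)

lemma reachable_if_rtrancl: "(u, v) \<in> (arcs_ends T)\<^sup>* \<Longrightarrow> u \<in> verts T \<Longrightarrow> u \<rightarrow>\<^sup>* v"
  unfolding reachable_def by (induction rule: rtrancl_induct) (auto intro: rtrancl_on_into_rtrancl_on adj_in_verts)

lemma reachable_via_tail:
  assumes "x \<rightarrow>\<^sup>* n" "x \<noteq> n"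
  obtains a where "a \<in> arcs T" "head T a = n" "x \<rightarrow>\<^sup>* tail T a"
proof -
  have "(x, n) \<in> (arcs_ends T)\<^sup>+" using assms by blast
  then obtain y where y: "(x, y) \<in> (arcs_ends T)\<^sup>*" "y \<rightarrow> n" by (meson tranclD2)
  then obtain a where "a \<in> arcs T" "tail T a = y" "head T a = n" by blast
  then show thesis using that y assms reachable_if_rtrancl reachable_in_verts by metis
qed

text \<open>Since at most one arrow leaves each vertex, the vertices reachable from \<open>x\<close>
  form a chain, so one of the two tails reaches the other. If the tails were distinct, this walk
  would pass through the common head and close a cycle.\<close>

lemma siblings_disjoint:
  assumes "a \<in> arcs T" "b \<in> arcs T" "head T a = head T b" "x \<rightarrow>\<^sup>* tail T a" "x \<rightarrow>\<^sup>* tail T b"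
  shows "a = b"
proof -
  have *: "a' = b'" if "a' \<in> arcs T" "b' \<in> arcs T" "head T a' = head T b'"
    "(tail T a', tail T b') \<in> (arcs_ends T)\<^sup>*" for a' b'
  proof (rule ccontr)
    assume "a' \<noteq> b'"
    then have "tail T a' \<noteq> tail T b'" using unique_out that by blast
    moreover have "tail T a' \<rightarrow>\<^sup>* tail T b'"
      using that by (intro reachable_if_rtrancl) auto
    ultimately have "head T a' \<rightarrow>\<^sup>* tail T b'" using head_reachable that(1) by blast
    then show False using not_head_reachable_tail that by metis
  qed
  show ?thesis
    using single_valued_confluent[OF single_valued_ends reachable_rtranclI[OF assms(4)]
        reachable_rtranclI[OF assms(5)]] * assms(1-3) by metis
qed

lemma all_reach_root: "n \<in> verts T \<Longrightarrow> n \<rightarrow>\<^sup>* r"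
proof (induction n rule: wf_induct_out[OF fin_digraph_axioms acyclic_ends])
  case (1 n)
  show ?case
  proof (cases "n = r")
    case False
    then obtain a where "a \<in> arcs T" "tail T a = n" using out_ex 1 by blast
    then show ?thesis using 1 tail_reachable by auto
  qed (use 1 in simp)
qed

lemma out_arrow_tail: "a \<in> arcs T \<Longrightarrow> out_arrow T (tail T a) = a"
  unfolding out_arrow_def using unique_out by blast

lemma arcs_branch: "arcs (branch T n) = {a \<in> arcs T. head T a \<rightarrow>\<^sup>* n}"
proof safe
  fix a assume "a \<in> arcs (branch T n)"
  then obtain x where x: "x \<rightarrow>\<^sup>* n" "x \<noteq> n" "a = out_arrow T x"
    by (auto simp: branch_def Let_def)
  then obtain b where b: "b \<in> arcs T" "tail T b = x" "head T b \<rightarrow>\<^sup>* n" using reachable_via_head by metis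
  then have "a = b" using x out_arrow_tail by blast
  then show "a \<in> arcs T" "head T a \<rightarrow>\<^sup>* n" using b by auto
next
  fix a assume a: "a \<in> arcs T" "head T a \<rightarrow>\<^sup>* n"
  then have "tail T a \<rightarrow>\<^sup>* n" "tail T a \<noteq> n"
    using tail_reachable not_head_reachable_tail by auto
  then show "a \<in> arcs (branch T n)"
    using a out_arrow_tail by (auto simp: branch_def Let_def intro!: image_eqI[of _ _ "tail T a"])
qed

lemma verts_branch: "verts (branch T n) = {m. m \<rightarrow>\<^sup>* n}"
  by (auto simp: branch_def Let_def dest: reachable_in_verts)

lemma tail_branch [simp]: "tail (branch T n) = tail T"
  and head_branch [simp]: "head (branch T n) = head T"
  by (auto simp: branch_def Let_def)

lemma in_tree_branch:
  assumes "n \<in> verts T"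
  shows "in_tree (branch T n) n"
proof (intro in_tree.intro in_tree_axioms.intro)
  show "fin_digraph (branch T n)"
  proof
    fix a assume "a \<in> arcs (branch T n)"
    then show "tail (branch T n) a \<in> verts (branch T n)" "head (branch T n) a \<in> verts (branch T n)"
      using tail_reachable by (auto simp: arcs_branch verts_branch)
  next
    show "finite (verts (branch T n))"
      by (rule finite_subset[of _ "verts T"]) (auto simp: branch_def Let_def)
    show "finite (arcs (branch T n))"
      by (simp add: arcs_branch)
  qed
  have "arcs_ends (branch T n) \<subseteq> arcs_ends T"
    by (auto simp: arcs_ends_def arc_to_ends_def arcs_branch)
  then show "acyclic (arcs_ends (branch T n))" using acyclic_ends by (rule acyclic_subset[rotated])
  show "n \<in> verts (branch T n)" using assms by (simp add: verts_branch)
  show "tail (branch T n) a \<noteq> n" if "a \<in> arcs (branch T n)" for a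
    using that not_head_reachable_tail by (auto simp: arcs_branch)
  show "\<exists>a\<in>arcs (branch T n). tail (branch T n) a = m" if "m \<in> verts (branch T n)" "m \<noteq> n" for m
    using that by (auto simp: arcs_branch verts_branch elim: reachable_via_head)
qed (use unique_out in \<open>auto simp: arcs_branch\<close>)

lemma in_arcs_branch: "m \<rightarrow>\<^sup>* n \<Longrightarrow> in_arcs (branch T n) m = in_arcs T m"
  by (auto simp: in_arcs_def arcs_branch)

end

text \<open>
  In a tree, \<open>sim T F n m\<close> means that \<open>n \<mapsto> m\<close> extends to a morphism of the branches that preserves
  the labels given by \<open>F\<close> to the arrows; the label of the vertex \<open>n\<close> itself is not compared.
\<close>

inductive sim :: "('n, 'e) pre_digraph \<Rightarrow> ('n, 'e, 'v, 'a) quiver_map \<Rightarrow> 'n \<Rightarrow> 'n \<Rightarrow> bool"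
  for T F where
  simI: "(\<And>a. a \<in> in_arcs T n \<Longrightarrow>
      \<exists>b\<in>in_arcs T m. amap F b = amap F a \<and> sim T F (tail T a) (tail T b)) \<Longrightarrow> sim T F n m"

lemma sim_trans: "sim T F n m \<Longrightarrow> sim T F m k \<Longrightarrow> sim T F n k"
proof (induction arbitrary: k rule: sim.induct)
  case (simI n m)
  show ?case
  proof (rule sim.simI)
    fix a assume "a \<in> in_arcs T n"
    then obtain b where b: "b \<in> in_arcs T m" "amap F b = amap F a"
      "\<And>k. sim T F (tail T b) k \<Longrightarrow> sim T F (tail T a) k" using simI.IH by blast
    then show "\<exists>c\<in>in_arcs T k. amap F c = amap F a \<and> sim T F (tail T a) (tail T c)"
      using simI.prems by (metis sim.cases)
  qed
qed

section \<open>From the relation \<open>sim\<close> to morphisms of branches\<close>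

context in_tree begin

text \<open>\<open>sim\<close> inspects incoming arrows only, and a branch keeps all incoming arrows
  of its vertices.\<close>

lemma sim_branch:
  assumes "sim T F n m" "n \<rightarrow>\<^sup>* k" "m \<rightarrow>\<^sup>* k"
  shows "sim (branch T k) F n m"
  using assms
proof (induction rule: sim.induct)
  case (simI n m)
  show ?case
  proof (rule sim.simI)
    fix a assume "a \<in> in_arcs (branch T k) n"
    then have "a \<in> in_arcs T n" using simI.prems in_arcs_branch by blast
    then obtain b where b: "b \<in> in_arcs T m" "amap F b = amap F a"
       "tail T a \<rightarrow>\<^sup>* k \<Longrightarrow> tail T b \<rightarrow>\<^sup>* k \<Longrightarrow> sim (branch T k) F (tail T a) (tail T b)"
      using simI.IH by blast
    moreover have "tail T a \<rightarrow>\<^sup>* k" "tail T b \<rightarrow>\<^sup>* k"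
      using \<open>a \<in> in_arcs T n\<close> b(1) simI.prems tail_reachable by auto
    ultimately have "b \<in> in_arcs T m" "amap F b = amap F a" "sim (branch T k) F (tail T a) (tail T b)"
      by simp_all
    then show "\<exists>b\<in>in_arcs (branch T k) m. amap F b = amap F a \<and>
        sim (branch T k) F (tail (branch T k) a) (tail (branch T k) b)"
      using simI.prems in_arcs_branch by auto
  qed
qed

text \<open>Bounds the length of walks by the number of vertices, so that a longest walk into the
  root exists.\<close>

lemma apath_if_awalk: "awalk u p v \<Longrightarrow> apath u p v"
proof -
  assume p: "awalk u p v"
  have "\<not> closed_w c" for c
    using acyclic_ends acyclic_arcs_ends_iff by blast
  then have "distinct (awalk_verts u p)"
    using awalk_not_distinct_decomp[OF p] by (auto simp: closed_w_def)
  then show "apath u p v" using p by (simp add: apath_def)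
qed

text \<open>The walk is copied from its end backwards, because \<open>sim\<close> matches the arrows
  into \<open>n\<close> with arrows into \<open>m\<close>.\<close>

lemma awalk_if_sim:
  assumes "sim T F n m" "m \<in> verts T" "awalk x p n"
  shows "\<exists>y q. awalk y q m \<and> length q = length p"
  using assms
proof (induction p arbitrary: n m rule: rev_induct)
  case Nil
  then show ?case using awalk_Nil_iff by blast
next
  case (snoc a p)
  then have a: "awalk x p (tail T a)" "a \<in> in_arcs T n" by (auto simp: awalk_simps)
  then obtain b where b: "b \<in> in_arcs T m" "sim T F (tail T a) (tail T b)"
    using snoc.prems(1) by (metis sim.cases)
  then obtain y q where "awalk y q (tail T b)" "length q = length p"
    using snoc.IH a(1) by (metis in_in_arcs_conv tail_in_verts)
  then have "awalk y (q @ [b]) m \<and> length (q @ [b]) = length (p @ [a])"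
    using b(1) by (auto simp: awalk_simps)
  then show ?case by blast
qed

text \<open>A longest walk that ends in the root has no longer one to compare with.\<close>

lemma sim_root:
  assumes "sim T F r m" "m \<in> verts T"
  shows "m = r"
proof -
  let ?P = "\<lambda>k. \<exists>x p. awalk x p r \<and> length p = k"
  have "?P 0" using awalk_Nil_iff root_in_verts by auto
  moreover have "\<forall>k. ?P k \<longrightarrow> k \<le> card (verts T)"
    using apath_if_awalk length_apath_less by (blast intro: less_imp_le)
  ultimately obtain k where k: "?P k" "\<And>l. ?P l \<Longrightarrow> l \<le> k"
    using Nat.ex_has_greatest_nat[of ?P 0] by blast
  obtain y q where q: "awalk y q m" "length q = k"
    using awalk_if_sim[OF assms] k(1) by blast
  obtain s where s: "awalk m s r" using all_reach_root[OF assms(2)] reachable_awalk by blast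
  have "awalk y (q @ s) r" using q s by auto
  then have "length (q @ s) \<le> k" using k(2) by blast
  then show ?thesis using q s by (auto simp: awalk_Nil_iff)
qed

text \<open>The branches at the children of \<open>n\<close> are disjoint by
  \<open>siblings_disjoint\<close>, so the maps obtained for them by induction can be glued;
  \<open>n\<close> itself is sent to \<open>m\<close>.\<close>

lemma sim_imp_branch_map:
  assumes "sim T F n m" "n \<in> verts T" "m \<in> verts T"
  shows "\<exists>f. f n = m \<and> (\<forall>a\<in>arcs (branch T n). \<exists>b\<in>arcs (branch T m).
      amap F b = amap F a \<and> tail T b = f (tail T a) \<and> head T b = f (head T a))"
  using assms
proof (induction rule: sim.induct)
  case (simI n m)
  let ?ok = "\<lambda>f n m. \<forall>a\<in>arcs (branch T n). \<exists>b\<in>arcs (branch T m).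
      amap F b = amap F a \<and> tail T b = f (tail T a) \<and> head T b = f (head T a)"
  have "\<forall>a\<in>in_arcs T n. \<exists>b g. b \<in> in_arcs T m \<and> amap F b = amap F a \<and>
      g (tail T a) = tail T b \<and> ?ok g (tail T a) (tail T b)"
    using simI.IH by fastforce
  then obtain \<beta> g where bg: "\<And>a. a \<in> in_arcs T n \<Longrightarrow> \<beta> a \<in> in_arcs T m \<and>
      amap F (\<beta> a) = amap F a \<and> g a (tail T a) = tail T (\<beta> a) \<and> ?ok (g a) (tail T a) (tail T (\<beta> a))"
    by metis
  \<comment> \<open>\<open>c x\<close> selects the arrow into \<open>n\<close> through which
    \<open>x\<close> reaches \<open>n\<close>, and thereby the map to be used at \<open>x\<close>.
    It is meaningful only for vertices below \<open>n\<close> other than \<open>n\<close>.\<close>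
  define c where "c x = (THE a. a \<in> in_arcs T n \<and> x \<rightarrow>\<^sup>* tail T a)" for x
  have c: "c x = a" if "a \<in> in_arcs T n" "x \<rightarrow>\<^sup>* tail T a" for x a
    unfolding c_def using that siblings_disjoint by (intro the_equality) auto
  define f where "f x = (if x = n then m else g (c x) x)" for x
  have "?ok f n m"
  proof
    fix a assume "a \<in> arcs (branch T n)"
    then have a: "a \<in> arcs T" "head T a \<rightarrow>\<^sup>* n" by (auto simp: arcs_branch)
    have tail_neq: "tail T a \<noteq> n" using a not_head_reachable_tail by blast
    show "\<exists>b\<in>arcs (branch T m). amap F b = amap F a \<and> tail T b = f (tail T a) \<and> head T b = f (head T a)"
    proof (cases "head T a = n")
      case True
      then have "a \<in> in_arcs T n" using a by simp
      moreover from this have "c (tail T a) = a" using c a by simp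
      ultimately show ?thesis using bg[of a] True tail_neq simI.prems
        by (intro bexI[of _ "\<beta> a"]) (auto simp: f_def arcs_branch)
    next
      case False
      then obtain d where d: "d \<in> arcs T" "head T d = n" "head T a \<rightarrow>\<^sup>* tail T d"
        using reachable_via_tail a by blast
      then have "c (head T a) = d" "c (tail T a) = d" "a \<in> arcs (branch T (tail T d))"
        using c d a tail_reachable by (auto simp: arcs_branch)
      moreover obtain b where "b \<in> arcs (branch T (tail T (\<beta> d)))" "amap F b = amap F a"
        "tail T b = g d (tail T a)" "head T b = g d (head T a)"
        using bg[of d] d calculation(3) by auto
      moreover have "b \<in> arcs (branch T m)"
        using \<open>b \<in> _\<close> bg[of d] d reachable_adjI reachable_trans
        by (fastforce simp: arcs_branch in_arcs_imp_in_arcs_ends)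
      ultimately show ?thesis using False tail_neq by (auto simp: f_def)
    qed
  qed
  then show ?case by (intro exI[of _ f]) (simp add: f_def)
qed

text \<open>Each vertex of the branch other than \<open>n\<close> is the tail of an arrow of the
  branch, so its label is determined by the label of that arrow. At \<open>n\<close> the equality of
  vertex labels is a separate hypothesis.\<close>

lemma sim_imp_branch_morphism:
  assumes F: "quiver_morphism T Q F"
    and sim: "sim T F n m" and n: "n \<in> verts T" and m: "m \<in> verts T" and eq: "vmap F n = vmap F m"
  shows "\<exists>\<iota>. quiver_morphism (branch T n) (branch T m) \<iota> \<and> vmap \<iota> n = m \<and>
    quiver_map_eq_on (branch T n) (quiver_map_comp F \<iota>) F"
proof -
  interpret B: in_tree "branch T m" m using m by (rule in_tree_branch)
  obtain f where f: "f n = m"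
    "\<And>c. c \<in> arcs (branch T n) \<Longrightarrow> \<exists>d\<in>arcs (branch T m).
      amap F d = amap F c \<and> tail T d = f (tail T c) \<and> head T d = f (head T c)"
    using sim_imp_branch_map[OF sim n m] by blast
  \<comment> \<open>An arrow of the tree is determined by its tail, so the vertex map dictates the
    arrow map.\<close>
  define \<iota> where "\<iota> = \<lparr>vmap = f, amap = \<lambda>c. out_arrow T (f (tail T c))\<rparr>"
  have amap: "amap \<iota> c \<in> arcs (branch T m) \<and> amap F (amap \<iota> c) = amap F c \<and>
      tail T (amap \<iota> c) = f (tail T c) \<and> head T (amap \<iota> c) = f (head T c)"
    if c: "c \<in> arcs (branch T n)" for c
  proof -
    obtain d where d: "d \<in> arcs (branch T m)" "amap F d = amap F c"
      "tail T d = f (tail T c)" "head T d = f (head T c)" using f(2)[OF c] by blast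
    then have "amap \<iota> c = d" using out_arrow_tail[of d] by (simp add: \<iota>_def arcs_branch)
    then show ?thesis using d by simp
  qed
  have vmap: "f x \<in> verts (branch T m) \<and> vmap F (f x) = vmap F x"
    if x: "x \<in> verts (branch T n)" for x
  proof (cases "x = n")
    case True
    then show ?thesis using f(1) eq B.root_in_verts by simp
  next
    case False
    then obtain c where c: "c \<in> arcs (branch T n)" "tail T c = x"
      using x by (auto simp: arcs_branch verts_branch elim: reachable_via_head)
    have "amap \<iota> c \<in> arcs T" "c \<in> arcs T" using amap[OF c(1)] c(1) by (simp_all add: arcs_branch)
    then have "vmap F (tail T (amap \<iota> c)) = vmap F (tail T c)"
      using F amap[OF c(1)] unfolding quiver_morphism_def by metis
    then show ?thesis
      using amap[OF c(1)] c(2) B.tail_in_verts[of "amap \<iota> c"] by simp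
  qed
  have "quiver_morphism (branch T n) (branch T m) \<iota>"
    using amap vmap by (auto simp: quiver_morphism_def) (simp_all add: \<iota>_def)
  moreover have "vmap \<iota> n = m" using f(1) by (simp add: \<iota>_def)
  moreover have "quiver_map_eq_on (branch T n) (quiver_map_comp F \<iota>) F"
    using amap vmap by (simp add: quiver_map_eq_on_def quiver_map_comp_def) (simp add: \<iota>_def)
  ultimately show ?thesis by blast
qed

lemma quiver_morphism_branch: "quiver_morphism T Q F \<Longrightarrow> quiver_morphism (branch T n) Q F"
  by (auto simp: quiver_morphism_def arcs_branch verts_branch image_subset_iff dest: reachable_in_verts(1))

end

section \<open>Decompositions from morphisms of branches\<close>

lemma subrep_restrict:
  assumes M: "fd_rep Q \<rho> M"
    and sub: "\<And>x. x \<in> verts Q \<Longrightarrow> module.subspace (smult M) (S x)"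
    and le: "\<And>x. S x \<subseteq> space M x"
    and closed: "\<And>\<gamma> v. \<gamma> \<in> arcs Q \<Longrightarrow> v \<in> S (tail Q \<gamma>) \<Longrightarrow> act M \<gamma> v \<in> S (head Q \<gamma>)"
  shows "subrep Q \<rho> (M\<lparr>space := S\<rparr>) M"
proof -
  interpret M: fd_rep Q \<rho> M by fact
  interpret V: vector_space "smult M" by (rule M.ambient)
  have "S x = {0}" if "x \<in> verts Q" "space M x = {0}" for x
    using that le[of x] V.subspace_0[OF sub, of x] by auto
  then have "{x \<in> verts Q. S x \<noteq> {0}} \<subseteq> {x \<in> verts Q. space M x \<noteq> {0}}" by blast
  then have "finite {x \<in> verts Q. S x \<noteq> {0}}" using M.finite_support by (rule finite_subset)
  moreover have "\<exists>B. finite B \<and> S x \<subseteq> V.span B" if "x \<in> verts Q" for x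
    using M.finite_dim[OF that] le[of x] by blast
  ultimately have "fd_rep Q \<rho> (M\<lparr>space := S\<rparr>)"
    using sub closed M.ambient M.act_add M.act_smult M.relations le[THEN subsetD]
    by (intro fd_rep.intro) simp_all
  then show ?thesis using le by (simp add: subrep_def)
qed

text \<open>The module is the sum of the fixed vectors and the kernel of \<open>\<theta>\<close>, by
  \<open>f = \<theta> f + (f - \<theta> f)\<close>. The last two groups of premises make both
  summands nonzero.\<close>

lemma decomposable_by_idempotent:
  assumes M: "fd_rep Q \<rho> M"
    and lin: "module_hom (smult M) (smult M) \<theta>"
    and closed: "\<And>x f. f \<in> space M x \<Longrightarrow> \<theta> f \<in> space M x"
    and comm: "\<And>\<gamma> f. \<gamma> \<in> arcs Q \<Longrightarrow> f \<in> space M (tail Q \<gamma>) \<Longrightarrow> \<theta> (act M \<gamma> f) = act M \<gamma> (\<theta> f)"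
    and idem: "\<And>x f. f \<in> space M x \<Longrightarrow> \<theta> (\<theta> f) = \<theta> f"
    and image: "x \<in> verts Q" "f \<in> space M x" "\<theta> f \<noteq> 0"
    and ker: "y \<in> verts Q" "g \<in> space M y" "\<theta> g = 0" "g \<noteq> 0"
  shows "decomposable Q \<rho> M"
proof -
  interpret M: fd_rep Q \<rho> M by fact
  interpret V: vector_space "smult M" by (rule M.ambient)
  interpret \<theta>: module_hom "smult M" "smult M" \<theta> by fact
  define U where "U x = {f \<in> space M x. \<theta> f = f}" for x
  define W where "W x = {f \<in> space M x. \<theta> f = 0}" for x
  \<comment> \<open>The action is additive only on the space at the tail of the arrow, so
    \<open>0\<close> must be known to lie there.\<close>
  have act0: "act M \<gamma> 0 = 0" if "\<gamma> \<in> arcs Q" "0 \<in> space M (tail Q \<gamma>)" for \<gamma>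
    using M.act_add[OF that(1) that(2) that(2)] by simp
  have "subrep Q \<rho> (M\<lparr>space := U\<rparr>) M"
  proof (rule subrep_restrict[OF M])
    fix x assume "x \<in> verts Q"
    then show "V.subspace (U x)"
      using M.subspace[of x] by (auto simp: U_def V.subspace_def \<theta>.add \<theta>.scale)
  qed (auto simp: U_def comm M.act_closed)
  moreover have "subrep Q \<rho> (M\<lparr>space := W\<rparr>) M"
  proof (rule subrep_restrict[OF M])
    fix x assume "x \<in> verts Q"
    then show "V.subspace (W x)"
      using M.subspace[of x] by (auto simp: W_def V.subspace_def \<theta>.add \<theta>.scale)
  next
    fix \<gamma> v assume "\<gamma> \<in> arcs Q" "v \<in> W (tail Q \<gamma>)"
    then show "act M \<gamma> v \<in> W (head Q \<gamma>)"
      using closed[of v "tail Q \<gamma>"] by (simp add: W_def comm M.act_closed act0)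
  qed (auto simp: W_def)
  moreover have "space M x = {u + w | u w. u \<in> U x \<and> w \<in> W x} \<and> U x \<inter> W x = {0}"
    if x: "x \<in> verts Q" for x
  proof (intro conjI subset_antisym subsetI)
    note sub = M.subspace[OF x]
    fix f assume f: "f \<in> space M x"
    then have "\<theta> f \<in> U x" "f - \<theta> f \<in> W x"
      using closed idem V.subspace_diff[OF sub] by (auto simp: U_def W_def \<theta>.diff)
    then show "f \<in> {u + w | u w. u \<in> U x \<and> w \<in> W x}"
      by (smt (verit) add_diff_cancel_left' diff_add_cancel add.commute mem_Collect_eq)
  next
    note sub = M.subspace[OF x]
    show "f \<in> space M x" if "f \<in> {u + w | u w. u \<in> U x \<and> w \<in> W x}" for f
      using that V.subspace_add[OF sub] by (auto simp: U_def W_def)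
    show "f \<in> U x \<inter> W x" if "f \<in> {0}" for f
      using that V.subspace_0[OF sub] by (auto simp: U_def W_def)
  qed (auto simp: U_def W_def)
  ultimately have "direct_sum_of Q \<rho> M (M\<lparr>space := U\<rparr>) (M\<lparr>space := W\<rparr>)"
    by (simp add: direct_sum_of_def)
  moreover have "nonzero_rep Q (M\<lparr>space := U\<rparr>)"
    using image closed idem by (auto simp: nonzero_rep_def U_def intro!: bexI[of _ x])
  moreover have "nonzero_rep Q (M\<lparr>space := W\<rparr>)"
    using ker by (auto simp: nonzero_rep_def W_def intro!: bexI[of _ y])
  ultimately show ?thesis unfolding decomposable_def by blast
qed

section \<open>Linear maps prescribed on basis vectors\<close>

definition lin_ext :: "('n \<Rightarrow> 'm \<Rightarrow>\<^sub>0 'k) \<Rightarrow> ('n \<Rightarrow>\<^sub>0 'k) \<Rightarrow> ('m \<Rightarrow>\<^sub>0 'k::field)" where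
  "lin_ext g f = (\<Sum>n\<in>Poly_Mapping.keys f. scale_pm (Poly_Mapping.lookup f n) (g n))"

lemma lin_ext_superset:
  assumes "finite S" "Poly_Mapping.keys f \<subseteq> S"
  shows "lin_ext g f = (\<Sum>n\<in>S. scale_pm (Poly_Mapping.lookup f n) (g n))"
  unfolding lin_ext_def using assms by (intro sum.mono_neutral_left) (auto simp: in_keys_iff)

lemma lin_ext_basis_vec [simp]: "lin_ext g (basis_vec n) = g n"
  by (simp add: lin_ext_def)

lemma lin_ext_basis_vec_id: "lin_ext basis_vec f = f"
proof (rule poly_mapping_eqI)
  fix k
  have "Poly_Mapping.lookup (lin_ext basis_vec f) k
      = (\<Sum>n\<in>Poly_Mapping.keys f. if n = k then Poly_Mapping.lookup f n else 0)"
    by (simp add: lin_ext_def lookup_sum lookup_scale_pm lookup_single when_def if_distrib[of "(*) _"]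
        cong: if_cong)
  then show "Poly_Mapping.lookup (lin_ext basis_vec f) k = Poly_Mapping.lookup f k"
    by (simp add: in_keys_iff)
qed

lemma module_hom_lin_ext:
  fixes g :: "'n \<Rightarrow> 'm \<Rightarrow>\<^sub>0 'k::field"
  shows "module_hom scale_pm scale_pm (lin_ext g)"
proof unfold_locales
  fix f h :: "'n \<Rightarrow>\<^sub>0 'k" and c :: 'k
  let ?S = "Poly_Mapping.keys f \<union> Poly_Mapping.keys h"
  have "Poly_Mapping.keys (f + h) \<subseteq> ?S" by (rule Poly_Mapping.keys_add)
  then show "lin_ext g (f + h) = lin_ext g f + lin_ext g h"
    by (simp add: lin_ext_superset[where S = ?S] lookup_add pm.scale_left_distrib sum.distrib)
  have "Poly_Mapping.keys (scale_pm c f) \<subseteq> Poly_Mapping.keys f"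
    by (auto simp: in_keys_iff lookup_scale_pm)
  then show "lin_ext g (scale_pm c f) = scale_pm c (lin_ext g f)"
    by (simp add: lin_ext_superset[where S = "Poly_Mapping.keys f"] lookup_scale_pm pm.scale_sum_right)
qed

lemma smult_tree_module [simp]: "smult (tree_module T F) = scale_pm"
  by (simp add: tree_module_def)

lemma act_tree_module_eq_lin_ext:
  "act (tree_module T F) \<gamma> =
     lin_ext (\<lambda>n. \<Sum>a | a \<in> arcs T \<and> tail T a = n \<and> amap F a = \<gamma>. basis_vec (head T a))"
  by (simp add: tree_module_def lin_ext_def fun_eq_iff)

lemma module_hom_act_tree_module: "module_hom scale_pm scale_pm (act (tree_module T F) \<gamma>)"
  unfolding act_tree_module_eq_lin_ext by (rule module_hom_lin_ext)

lemma basis_vec_in_space: "n \<in> verts T \<Longrightarrow> basis_vec n \<in> space (tree_module T F) (vmap F n)"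
  by (auto simp: tree_module_def intro!: pm.span_base)

lemma hom_eq_on_space:
  assumes "module_hom scale_pm scale_pm \<phi>" "module_hom scale_pm scale_pm \<psi>"
    and "\<And>n. n \<in> verts T \<Longrightarrow> vmap F n = x \<Longrightarrow> \<phi> (basis_vec n) = \<psi> (basis_vec n)"
    and "f \<in> space (tree_module T F) x"
  shows "\<phi> f = \<psi> f"
proof -
  interpret module_pair "scale_pm :: 'a \<Rightarrow> ('b \<Rightarrow>\<^sub>0 'a) \<Rightarrow> _" "scale_pm :: 'a \<Rightarrow> ('c \<Rightarrow>\<^sub>0 'a) \<Rightarrow> _" ..
  show ?thesis
  proof (rule module_hom_eq_on_span[OF assms(1,2)])
    show "f \<in> pm.span {basis_vec n | n. n \<in> verts T \<and> vmap F n = x}"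
      using assms(4) by (simp add: tree_module_def)
  qed (use assms(3) in auto)
qed

context in_tree begin

lemma act_basis_vec_tail:
  assumes "a \<in> arcs T"
  shows "act (tree_module T F) \<gamma> (basis_vec (tail T a)) = (if amap F a = \<gamma> then basis_vec (head T a) else 0)"
proof -
  have "{b \<in> arcs T. tail T b = tail T a \<and> amap F b = \<gamma>} = (if amap F a = \<gamma> then {a} else {})"
    using assms unique_out by auto
  then show ?thesis by (simp add: act_tree_module_eq_lin_ext)
qed

lemma act_basis_vec_other:
  assumes "\<nexists>a. a \<in> arcs T \<and> tail T a = n \<and> amap F a = \<gamma>"
  shows "act (tree_module T F) \<gamma> (basis_vec n) = 0"
proof -
  have none: "{b \<in> arcs T. tail T b = n \<and> amap F b = \<gamma>} = {}" using assms by auto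
  show ?thesis by (simp only: act_tree_module_eq_lin_ext lin_ext_basis_vec none sum.empty)
qed

text \<open>At the top of the first branch, \<open>a\<close> and \<open>b\<close> send both terms of
  the difference to the same vector, so it is killed. Further down \<open>\<theta>\<close> commutes
  with the arrows because the morphism does, and outside the branch both composites vanish.\<close>

lemma decomposable_if_sibling_morphism:
  fixes F :: "('n, 'e, 'v, 'a) quiver_map"
  assumes M: "fd_rep Q \<rho> (tree_module T F :: ('v, 'a, 'k::field, 'n \<Rightarrow>\<^sub>0 'k) quiver_rep)"
    and F: "quiver_morphism T Q F"
    and ab: "a \<in> arcs T" "b \<in> arcs T" "a \<noteq> b" "head T a = head T b" "amap F a = amap F b"
    and \<iota>: "quiver_morphism (branch T (tail T a)) (branch T (tail T b)) \<iota>" "vmap \<iota> (tail T a) = tail T b"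
      "quiver_map_eq_on (branch T (tail T a)) (quiver_map_comp F \<iota>) F"
  shows "decomposable Q \<rho> (tree_module T F :: ('v, 'a, 'k, 'n \<Rightarrow>\<^sub>0 'k) quiver_rep)"
proof -
  let ?M = "tree_module T F :: ('v, 'a, 'k, 'n \<Rightarrow>\<^sub>0 'k) quiver_rep"
  let ?n = "tail T a" and ?m = "tail T b"
  define f where "f = vmap \<iota>"
  have f: "f ?n = ?m" using \<iota>(2) by (simp add: f_def)
  have amap_\<iota>: "amap \<iota> c \<in> arcs (branch T ?m)" "amap F (amap \<iota> c) = amap F c"
      "tail T (amap \<iota> c) = f (tail T c)" "head T (amap \<iota> c) = f (head T c)"
    if "c \<in> arcs (branch T ?n)" for c
    using \<iota>(1,3) that
    by (auto simp: quiver_morphism_def quiver_map_eq_on_def quiver_map_comp_def f_def)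
  define \<theta> :: "('n \<Rightarrow>\<^sub>0 'k) \<Rightarrow> ('n \<Rightarrow>\<^sub>0 'k)" where
    "\<theta> = lin_ext (\<lambda>y. if y \<rightarrow>\<^sup>* ?n then basis_vec y - basis_vec (f y) else 0)"
  have hom: "module_hom scale_pm scale_pm \<theta>" unfolding \<theta>_def by (rule module_hom_lin_ext)
  interpret \<theta>: module_hom "scale_pm :: 'k \<Rightarrow> ('n \<Rightarrow>\<^sub>0 'k) \<Rightarrow> _" scale_pm \<theta> by fact
  interpret act: module_hom "scale_pm :: 'k \<Rightarrow> ('n \<Rightarrow>\<^sub>0 'k) \<Rightarrow> _" scale_pm "act ?M \<gamma>" for \<gamma>
    by (rule module_hom_act_tree_module)
  have \<theta>1: "\<theta> (basis_vec y) = basis_vec y - basis_vec (f y)" if "y \<rightarrow>\<^sup>* ?n" for y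
    using that by (simp add: \<theta>_def)
  have \<theta>0: "\<theta> (basis_vec y) = 0" if "\<not> y \<rightarrow>\<^sup>* ?n" for y
    using that by (simp add: \<theta>_def)
  have lower: "\<exists>c d. c \<in> arcs T \<and> d \<in> arcs T \<and> tail T c = y \<and> head T c \<rightarrow>\<^sup>* ?n \<and>
      tail T d = f y \<and> head T d = f (head T c) \<and> head T d \<rightarrow>\<^sup>* ?m \<and> amap F d = amap F c"
    if y: "y \<rightarrow>\<^sup>* ?n" "y \<noteq> ?n" for y
  proof -
    obtain c where "c \<in> arcs T" "tail T c = y" "head T c \<rightarrow>\<^sup>* ?n" using reachable_via_head[OF y] by blast
    then show ?thesis using amap_\<iota>[of c] by (intro exI[of _ c] exI[of _ "amap \<iota> c"]) (auto simp: arcs_branch)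
  qed
  have f_reach: "f y \<rightarrow>\<^sup>* ?m" if "y \<rightarrow>\<^sup>* ?n" for y
    using lower[OF that] f ab tail_reachable by (cases "y = ?n") (auto, metis)
  \<comment> \<open>Sibling branches are disjoint. Hence \<open>\<theta>\<close> kills
    \<open>basis_vec (f y)\<close>, which makes it idempotent.\<close>
  have not_reach: "\<not> f y \<rightarrow>\<^sup>* ?n" if "y \<rightarrow>\<^sup>* ?n" for y
    using siblings_disjoint ab f_reach[OF that] by metis
  have F_f: "vmap F (f y) = vmap F y" if "y \<rightarrow>\<^sup>* ?n" for y
    using lower[OF that] F f ab by (cases "y = ?n") (auto simp: quiver_morphism_def, metis+)
  have neq: "?n \<noteq> ?m" using ab unique_out by blast
  show ?thesis
  proof (rule decomposable_by_idempotent[OF M, of \<theta>])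
    show "module_hom (smult ?M) (smult ?M) \<theta>" using hom by simp
  next
    fix x g assume g: "g \<in> space ?M x"
    have sp: "pm.subspace (space ?M z)" for z by (simp add: tree_module_def)
    show "\<theta> g \<in> space ?M x"
      unfolding \<theta>_def lin_ext_def
    proof (intro pm.subspace_sum[OF sp] pm.subspace_scale[OF sp])
      fix y assume "y \<in> Poly_Mapping.keys g"
      then have "y \<in> verts T" "vmap F y = x" using keys_space_tree_module[OF g] by auto
      then show "(if y \<rightarrow>\<^sup>* ?n then basis_vec y - basis_vec (f y) else 0) \<in> space ?M x"
        using basis_vec_in_space[of y T F] basis_vec_in_space[of "f y" T F] F_f[of y] f_reach[of y]
          reachable_in_verts(1)[of "f y"]
        by (auto intro!: pm.subspace_diff[OF sp] pm.subspace_0[OF sp])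
    qed
    show "\<theta> (\<theta> g) = \<theta> g"
    proof (rule hom_eq_on_space[OF module_hom_compose[OF hom hom, unfolded comp_def] hom _ g])
      fix y
      show "\<theta> (\<theta> (basis_vec y)) = \<theta> (basis_vec y)"
        by (cases "y \<rightarrow>\<^sup>* ?n") (simp_all add: \<theta>1 \<theta>0 \<theta>.diff not_reach)
    qed
  next
    fix \<gamma> g assume \<gamma>: "\<gamma> \<in> arcs Q" and g: "g \<in> space ?M (tail Q \<gamma>)"
    show "\<theta> (act ?M \<gamma> g) = act ?M \<gamma> (\<theta> g)"
    proof (rule hom_eq_on_space[OF module_hom_compose[OF act.module_hom_axioms hom, unfolded comp_def]
          module_hom_compose[OF hom act.module_hom_axioms, unfolded comp_def] _ g])
      fix y assume y: "y \<in> verts T"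
      consider "y = ?n" | "y \<rightarrow>\<^sup>* ?n" "y \<noteq> ?n" | "\<not> y \<rightarrow>\<^sup>* ?n" by blast
      then show "\<theta> (act ?M \<gamma> (basis_vec y)) = act ?M \<gamma> (\<theta> (basis_vec y))"
      proof cases
        case 1
        then show ?thesis
          using ab y not_head_reachable_tail[OF ab(1)]
          by (simp add: act_basis_vec_tail \<theta>1 \<theta>0 f act.diff)
      next
        case 2
        then obtain c d where cd: "c \<in> arcs T" "d \<in> arcs T" "tail T c = y" "head T c \<rightarrow>\<^sup>* ?n"
          "tail T d = f y" "head T d = f (head T c)" "amap F d = amap F c" using lower by blast
        then show ?thesis
          using act_basis_vec_tail[OF cd(1), of F \<gamma>, where 'a = 'k] act_basis_vec_tail[OF cd(2), of F \<gamma>, where 'a = 'k] 2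
          by (simp add: \<theta>1 act.diff)
      next
        case 3
        show ?thesis
        proof (cases "\<exists>c. c \<in> arcs T \<and> tail T c = y \<and> amap F c = \<gamma>")
          case True
          then obtain c where c: "c \<in> arcs T" "tail T c = y" "amap F c = \<gamma>" by blast
          then have "\<not> head T c \<rightarrow>\<^sup>* ?n" using 3 tail_reachable by blast
          then show ?thesis using c 3 act_basis_vec_tail[OF c(1), of F \<gamma>, where 'a = 'k] by (simp add: \<theta>0)
        qed (simp add: 3 act_basis_vec_other \<theta>0)
      qed
    qed
  next
    show "vmap F ?n \<in> verts Q" "vmap F (head T a) \<in> verts Q"
      using F ab by (auto simp: quiver_morphism_def)
    show "basis_vec ?n \<in> space ?M (vmap F ?n)" "basis_vec (head T a) \<in> space ?M (vmap F (head T a))"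
      using ab by (auto intro: basis_vec_in_space)
    \<comment> \<open>The tail of \<open>a\<close> witnesses that \<open>\<theta>\<close> is
      nonzero, and the common head, lying outside the first branch, that its kernel is
      nonzero.\<close>
    have "Poly_Mapping.lookup (\<theta> (basis_vec ?n)) ?n = 1"
      using neq ab by (simp add: \<theta>1 f lookup_minus lookup_single)
    then show "\<theta> (basis_vec ?n) \<noteq> 0" by auto
    show "\<theta> (basis_vec (head T a)) = 0" using not_head_reachable_tail[OF ab(1)] by (simp add: \<theta>0)
    show "basis_vec (head T a) \<noteq> (0 :: 'n \<Rightarrow>\<^sub>0 'k)" by (metis zero_neq_one lookup_single_eq lookup_zero)
  qed
qed

end

section \<open>Indecomposability\<close>

lemma direct_sum_of_commute: "direct_sum_of Q \<rho> M U W \<Longrightarrow> direct_sum_of Q \<rho> M W U"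
  unfolding direct_sum_of_def
  by (auto simp: Int_commute) (metis add.commute)+

text \<open>The assumptions are symmetric in \<open>U\<close> and \<open>W\<close>, so the results
  can also be used with the two summands exchanged.\<close>

locale tree_splitting = in_tree T r
  for T :: "('n, 'e) pre_digraph" (structure) and r +
  fixes Q :: "('v, 'a) pre_digraph" and \<rho> :: "('v, 'a) path set"
    and F :: "('n, 'e, 'v, 'a) quiver_map"
    and U W :: "('v, 'a, 'k::field, 'n \<Rightarrow>\<^sub>0 'k) quiver_rep"
  assumes morphism: "quiver_morphism T Q F"
    and splitting: "direct_sum_of Q \<rho> (tree_module T F) U W"
    and no_sim_siblings: "a \<in> arcs T \<Longrightarrow> b \<in> arcs T \<Longrightarrow> a \<noteq> b \<Longrightarrow> head T a = head T b \<Longrightarrow>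
      amap F a = amap F b \<Longrightarrow> \<not> sim T F (tail T a) (tail T b)"
begin

abbreviation M :: "('v, 'a, 'k, 'n \<Rightarrow>\<^sub>0 'k) quiver_rep" where
  "M \<equiv> tree_module T F"

lemma vmap_in_verts: "n \<in> verts T \<Longrightarrow> vmap F n \<in> verts Q"
  and amap_in_arcs: "a \<in> arcs T \<Longrightarrow> amap F a \<in> arcs Q"
  and tail_amap: "a \<in> arcs T \<Longrightarrow> tail Q (amap F a) = vmap F (tail T a)"
  and head_amap: "a \<in> arcs T \<Longrightarrow> head Q (amap F a) = vmap F (head T a)"
  using morphism by (auto simp: quiver_morphism_def)

lemma fd_rep_U: "fd_rep Q \<rho> U" and fd_rep_W: "fd_rep Q \<rho> W"
  and smult_U: "smult U = scale_pm" and smult_W: "smult W = scale_pm"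
  using splitting by (auto simp: direct_sum_of_def subrep_def)

lemma subspace_U: "x \<in> verts Q \<Longrightarrow> pm.subspace (space U x)"
  using fd_rep.subspace[OF fd_rep_U] smult_U by metis

lemma subspace_W: "x \<in> verts Q \<Longrightarrow> pm.subspace (space W x)"
  using fd_rep.subspace[OF fd_rep_W] smult_W by metis

lemma space_U_le: "x \<in> verts Q \<Longrightarrow> f \<in> space U x \<Longrightarrow> f \<in> space M x"
  using splitting unfolding direct_sum_of_def subrep_def by blast

lemma act_in_U: "\<gamma> \<in> arcs Q \<Longrightarrow> f \<in> space U (tail Q \<gamma>) \<Longrightarrow> act M \<gamma> f \<in> space U (head Q \<gamma>)"
  using splitting fd_rep.act_closed[OF fd_rep_U] by (force simp: direct_sum_of_def subrep_def)

lemma act_in_W: "\<gamma> \<in> arcs Q \<Longrightarrow> f \<in> space W (tail Q \<gamma>) \<Longrightarrow> act M \<gamma> f \<in> space W (head Q \<gamma>)"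
  using splitting fd_rep.act_closed[OF fd_rep_W] by (force simp: direct_sum_of_def subrep_def)

lemma inter_zero: "x \<in> verts Q \<Longrightarrow> f \<in> space U x \<Longrightarrow> f \<in> space W x \<Longrightarrow> f = 0"
  using splitting by (auto simp: direct_sum_of_def)

lemma splitting_unique:
  assumes x: "x \<in> verts Q" and "f \<in> space U x" "g \<in> space W x" "f' \<in> space U x" "g' \<in> space W x"
    and eq: "f + g = f' + g'"
  shows "f = f'"
proof -
  have "f - f' = g' - g" using eq by (simp add: algebra_simps)
  moreover have "f - f' \<in> space U x" "g' - g \<in> space W x"
    using assms subspace_U subspace_W by (simp_all add: pm.subspace_diff)
  ultimately have "f - f' = 0" using inter_zero[OF x] by metis
  then show ?thesis by simp
qed

text \<open>The projection of the basis vector to \<open>U\<close> along \<open>W\<close>. Existence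
  is shown for vertices of the tree in \<open>u_in\<close>, uniqueness in
  \<open>u_eqI\<close>.\<close>

definition u :: "'n \<Rightarrow> 'n \<Rightarrow>\<^sub>0 'k" where
  "u n = (SOME f. f \<in> space U (vmap F n) \<and> basis_vec n - f \<in> space W (vmap F n))"

lemma u_in: "u n \<in> space U (vmap F n)" and basis_vec_minus_u_in: "basis_vec n - u n \<in> space W (vmap F n)"
  if "n \<in> verts T"
proof -
  have "basis_vec n \<in> {f + g | f g. f \<in> space U (vmap F n) \<and> g \<in> space W (vmap F n)}"
    using splitting basis_vec_in_space[OF that] vmap_in_verts[OF that]
    unfolding direct_sum_of_def by blast
  then obtain f g where "f \<in> space U (vmap F n)" "g \<in> space W (vmap F n)" "basis_vec n = f + g" by blast
  then have "f \<in> space U (vmap F n) \<and> basis_vec n - f \<in> space W (vmap F n)" by simp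
  then have "u n \<in> space U (vmap F n) \<and> basis_vec n - u n \<in> space W (vmap F n)"
    unfolding u_def by (rule someI)
  then show "u n \<in> space U (vmap F n)" "basis_vec n - u n \<in> space W (vmap F n)" by auto
qed

lemma u_eqI:
  assumes "n \<in> verts T" "f \<in> space U (vmap F n)" "basis_vec n - f \<in> space W (vmap F n)"
  shows "u n = f"
  by (rule splitting_unique[OF vmap_in_verts[OF assms(1)] u_in[OF assms(1)]
        basis_vec_minus_u_in[OF assms(1)] assms(2,3)]) simp

lemma act_diff: "act M \<gamma> (f - g) = act M \<gamma> f - act M \<gamma> g"
  by (rule module_hom.diff[OF module_hom_act_tree_module])

text \<open>Both summands are closed under the action, so the projection commutes with
  arrows.\<close>

lemma act_u_tail:
  assumes a: "a \<in> arcs T"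
  shows "act M (amap F a) (u (tail T a)) = u (head T a)"
proof (rule u_eqI[symmetric])
  show "act M (amap F a) (u (tail T a)) \<in> space U (vmap F (head T a))"
    using act_in_U[OF amap_in_arcs[OF a]] u_in a by (simp add: tail_amap head_amap)
  have "act M (amap F a) (basis_vec (tail T a) - u (tail T a)) \<in> space W (vmap F (head T a))"
    using act_in_W[OF amap_in_arcs[OF a]] basis_vec_minus_u_in a by (simp add: tail_amap head_amap)
  then show "basis_vec (head T a) - act M (amap F a) (u (tail T a)) \<in> space W (vmap F (head T a))"
    using a by (simp add: act_diff act_basis_vec_tail)
qed (use a in simp)

text \<open>The arrow kills \<open>basis_vec n\<close>, so the images of its two components add up
  to zero. They lie in \<open>U\<close> and in \<open>W\<close>, hence both vanish.\<close>

lemma act_u_other: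
  assumes n: "n \<in> verts T" and b: "b \<in> arcs T" and eq: "vmap F n = vmap F (tail T b)"
    and none: "\<nexists>a. a \<in> arcs T \<and> tail T a = n \<and> amap F a = amap F b"
  shows "act M (amap F b) (u n) = 0"
proof -
  let ?x = "vmap F (head T b)"
  have U: "act M (amap F b) (u n) \<in> space U ?x"
    using act_in_U[OF amap_in_arcs[OF b]] u_in[OF n] b eq by (simp add: tail_amap head_amap)
  have "act M (amap F b) (basis_vec n - u n) \<in> space W ?x"
    using act_in_W[OF amap_in_arcs[OF b]] basis_vec_minus_u_in[OF n] b eq by (simp add: tail_amap head_amap)
  then have "- act M (amap F b) (u n) \<in> space W ?x"
    by (simp add: act_diff act_basis_vec_other[OF none])
  then have "- (- act M (amap F b) (u n)) \<in> space W ?x"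
    by (rule pm.subspace_neg[OF subspace_W[OF vmap_in_verts[OF head_in_verts[OF b]]]])
  then have "act M (amap F b) (u n) \<in> space W ?x" by simp
  then show ?thesis using inter_zero U vmap_in_verts b by (meson head_in_verts)
qed

lemma lookup_act:
  "Poly_Mapping.lookup (act M \<gamma> f) m
     = (\<Sum>b | b \<in> in_arcs T m \<and> amap F b = \<gamma>. Poly_Mapping.lookup f (tail T b))"
proof -
  \<comment> \<open>The vertices of the tree are added to the index set so that it contains the tail
    of every arrow, and the arrows can be grouped by tails.\<close>
  let ?S = "Poly_Mapping.keys f \<union> verts T" and ?A = "{a \<in> arcs T. amap F a = \<gamma>}"
  let ?h = "\<lambda>a. Poly_Mapping.lookup f (tail T a) * (if head T a = m then 1 else 0)"
  have "Poly_Mapping.lookup (act M \<gamma> f) m = (\<Sum>n\<in>?S. \<Sum>a | a \<in> ?A \<and> tail T a = n. ?h a)"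
    by (subst act_tree_module[where S = ?S])
      (auto simp: lookup_sum lookup_scale_pm sum_distrib_left lookup_single when_def intro!: sum.cong)
  also have "\<dots> = (\<Sum>a\<in>?A. ?h a)"
    by (rule sum.group) auto
  also have "\<dots> = (\<Sum>a | a \<in> in_arcs T m \<and> amap F a = \<gamma>. ?h a)"
    by (rule sum.mono_neutral_right) auto
  also have "\<dots> = (\<Sum>b | b \<in> in_arcs T m \<and> amap F b = \<gamma>. Poly_Mapping.lookup f (tail T b))"
    by (rule sum.cong) auto
  finally show ?thesis .
qed

lemma coeff_in_verts:
  assumes "n \<in> verts T" "Poly_Mapping.lookup (u n) m \<noteq> 0"
  shows "m \<in> verts T" "vmap F m = vmap F n"
  using keys_space_tree_module[OF space_U_le[OF vmap_in_verts[OF assms(1)] u_in[OF assms(1)]]] assms(2)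
  by (auto simp: in_keys_iff)

text \<open>Induction from the leaves. For an arrow \<open>a\<close> into \<open>n\<close>,
  \<open>u n\<close> is the image of \<open>u (tail T a)\<close>, so \<open>m\<close> is the head of
  an arrow with the same label whose tail occurs in \<open>u (tail T a)\<close>.\<close>

lemma coeff_sim:
  assumes "n \<in> verts T" "Poly_Mapping.lookup (u n) m \<noteq> 0"
  shows "sim T F n m"
proof -
  have "finite (arcs_ends T)" by (simp add: arcs_ends_def)
  then have "wf (arcs_ends T)" using acyclic_ends by (rule finite_acyclic_wf)
  then show ?thesis using assms
  proof (induction n arbitrary: m rule: wf_induct_rule)
    case (less n)
    show ?case
    proof (rule simI)
      fix a assume a: "a \<in> in_arcs T n"
      then have "m \<in> Poly_Mapping.keys (act M (amap F a) (u (tail T a)))"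
        using less.prems act_u_tail[of a] by (simp add: in_keys_iff)
      then obtain b where b: "b \<in> arcs T" "tail T b \<in> Poly_Mapping.keys (u (tail T a))"
        "amap F b = amap F a" "m = head T b"
        using keys_act_tree_module[of T F "amap F a" "u (tail T a)"] by auto
      moreover have "sim T F (tail T a) (tail T b)"
        using a b less.IH in_arcs_imp_in_arcs_ends by (fastforce simp: in_keys_iff)
      ultimately show "\<exists>b\<in>in_arcs T m. amap F b = amap F a \<and> sim T F (tail T a) (tail T b)"
        by auto
    qed
  qed
qed

text \<open>Under the last premise only the summand at \<open>b\<close> survives in
  \<open>lookup_act\<close>, so the coefficient moves up to the parents unchanged.\<close>

lemma coeff_head:
  assumes "a \<in> arcs T" "b \<in> arcs T" "amap F a = amap F b"
    and "\<And>c. c \<in> arcs T \<Longrightarrow> c \<noteq> b \<Longrightarrow> head T c = head T b \<Longrightarrow> amap F c = amap F b \<Longrightarrow>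
      Poly_Mapping.lookup (u (tail T a)) (tail T c) = 0"
  shows "Poly_Mapping.lookup (u (head T a)) (head T b) = Poly_Mapping.lookup (u (tail T a)) (tail T b)"
proof -
  have "Poly_Mapping.lookup (u (head T a)) (head T b)
      = (\<Sum>c | c \<in> in_arcs T (head T b) \<and> amap F c = amap F a. Poly_Mapping.lookup (u (tail T a)) (tail T c))"
    using act_u_tail[OF assms(1)] lookup_act by metis
  also have "\<dots> = (\<Sum>c\<in>{b}. Poly_Mapping.lookup (u (tail T a)) (tail T c))"
    using assms by (intro sum.mono_neutral_right) auto
  finally show ?thesis by simp
qed

text \<open>The root is similar to every vertex that occurs in \<open>u r\<close>, and by
  \<open>sim_root\<close> only to itself.\<close>

lemma u_root: "u r = scale_pm (Poly_Mapping.lookup (u r) r) (basis_vec r)"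
proof (rule poly_mapping_eqI)
  fix m
  show "Poly_Mapping.lookup (u r) m = Poly_Mapping.lookup (scale_pm (Poly_Mapping.lookup (u r) r) (basis_vec r)) m"
    using coeff_sim[OF root_in_verts, of m] coeff_in_verts[OF root_in_verts, of m] sim_root[of F m]
    by (auto simp: lookup_scale_pm lookup_single when_def)
qed

lemma basis_vec_root_in_U:
  assumes "Poly_Mapping.lookup (u r) r \<noteq> 0"
  shows "basis_vec r \<in> space U (vmap F r)"
proof -
  have "basis_vec r = scale_pm (inverse (Poly_Mapping.lookup (u r) r)) (u r)"
    using assms by (subst (2) u_root) simp
  then show ?thesis
    using u_in[OF root_in_verts] pm.subspace_scale subspace_U vmap_in_verts root_in_verts by metis
qed

text \<open>The support of the matrix of the projection onto \<open>U\<close>, as a relation, so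
  that cycles and well-founded induction make sense for it.\<close>

definition coeffs :: "('n \<times> 'n) set" where
  "coeffs = {(n, m). n \<in> verts T \<and> Poly_Mapping.lookup (u n) m \<noteq> 0}"

lemma coeffs_trancl_sim: "(n, m) \<in> coeffs\<^sup>+ \<Longrightarrow> sim T F n m"
  by (induction rule: trancl_induct) (auto simp: coeffs_def intro: coeff_sim sim_trans)

text \<open>
  The vertices on a cycle are similar to each other, so a nonzero coefficient that could cancel the
  one at \<open>m\<close> would belong to a sibling similar to \<open>m\<close>.
\<close>

lemma coeffs_head:
  assumes c0: "Poly_Mapping.lookup (u r) r = 0" and nm: "(n, m) \<in> coeffs" and sim: "sim T F m n"
  shows "\<exists>a b. a \<in> arcs T \<and> b \<in> arcs T \<and> tail T a = n \<and> tail T b = m \<and> (head T a, head T b) \<in> coeffs"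
proof -
  have n: "n \<in> verts T" and coeff: "Poly_Mapping.lookup (u n) m \<noteq> 0" using nm by (auto simp: coeffs_def)
  note m = coeff_in_verts[OF n coeff]
  \<comment> \<open>If \<open>m\<close> were the root, similarity would force \<open>n\<close> to be
    the root as well, where the coefficient is zero by \<open>c0\<close>.\<close>
  have "m \<noteq> r" using sim_root[of F n] sim n coeff c0 by metis
  then obtain b where b: "b \<in> arcs T" "tail T b = m" using out_ex m by blast
  have other: "Poly_Mapping.lookup (u n) (tail T c) = 0"
    if "c \<in> arcs T" "c \<noteq> b" "head T c = head T b" "amap F c = amap F b" for c
    using no_sim_siblings[of b c] coeff_sim[OF n] sim_trans[OF sim] that b by metis
  show ?thesis
  proof (cases "\<exists>a. a \<in> arcs T \<and> tail T a = n \<and> amap F a = amap F b")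
    case True
    then obtain a where a: "a \<in> arcs T" "tail T a = n" "amap F a = amap F b" by blast
    then have "Poly_Mapping.lookup (u (head T a)) (head T b) = Poly_Mapping.lookup (u n) m"
      using coeff_head[OF a(1) b(1) a(3)] other b by simp
    then have "(head T a, head T b) \<in> coeffs" using a coeff by (auto simp: coeffs_def)
    then show ?thesis using a b by blast
  next
    case False
    \<comment> \<open>Here an arrow with the label of \<open>b\<close> kills \<open>u n\<close>,
      while the coefficient of the image at the head of \<open>b\<close> is the nonzero one at
      \<open>m\<close>.\<close>
    have "0 = (\<Sum>c | c \<in> in_arcs T (head T b) \<and> amap F c = amap F b. Poly_Mapping.lookup (u n) (tail T c))"
      using act_u_other[OF n b(1) _ False] m b lookup_act[of "amap F b" "u n" "head T b"] by simp
    also have "\<dots> = (\<Sum>c\<in>{b}. Poly_Mapping.lookup (u n) (tail T c))"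
      using b other by (intro sum.mono_neutral_right) auto
    finally show ?thesis using coeff b by simp
  qed
qed

text \<open>The premise \<open>sim T F m n\<close> closes the chain up to similarity, so
  \<open>coeffs_head\<close> applies to each step. Consecutive lifted steps fit together because an
  intermediate vertex has only one outgoing arrow.\<close>

lemma coeffs_trancl_head:
  assumes c0: "Poly_Mapping.lookup (u r) r = 0" and "(n, m) \<in> coeffs\<^sup>+" "sim T F m n"
  shows "\<exists>a b. a \<in> arcs T \<and> b \<in> arcs T \<and> tail T a = n \<and> tail T b = m \<and> (head T a, head T b) \<in> coeffs\<^sup>+"
  using assms(2,3)
proof (induction rule: trancl_induct)
  case (base m)
  then show ?case using coeffs_head[OF c0] by blast
next
  case (step k m)
  have "sim T F k n" by (rule sim_trans[OF coeffs_trancl_sim[OF r_into_trancl[OF step.hyps(2)]] step.prems])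
  then obtain a b where ab: "a \<in> arcs T" "b \<in> arcs T" "tail T a = n" "tail T b = k"
    "(head T a, head T b) \<in> coeffs\<^sup>+"
    using step.IH by blast
  have "sim T F m k" by (rule sim_trans[OF step.prems coeffs_trancl_sim[OF step.hyps(1)]])
  then obtain a' b' where ab': "a' \<in> arcs T" "b' \<in> arcs T" "tail T a' = k" "tail T b' = m"
    "(head T a', head T b') \<in> coeffs"
    using coeffs_head[OF c0 step.hyps(2)] by blast
  have "b = a'" using ab ab' unique_out by simp
  then have "(head T a, head T b') \<in> coeffs\<^sup>+" using ab(5) ab'(5) by (simp add: trancl_into_trancl)
  then show ?case using ab ab' by blast
qed

lemma acyclic_coeffs:
  assumes "Poly_Mapping.lookup (u r) r = 0"
  shows "acyclic coeffs"
  unfolding acyclic_def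
proof
  fix n
  show "(n, n) \<notin> coeffs\<^sup>+"
  proof (induction n rule: wf_induct_out[OF fin_digraph_axioms acyclic_ends])
    case (1 n)
    show ?case
    proof
      assume "(n, n) \<in> coeffs\<^sup>+"
      then obtain a b where "a \<in> arcs T" "b \<in> arcs T" "tail T a = n" "tail T b = n"
        "(head T a, head T b) \<in> coeffs\<^sup>+"
        using coeffs_trancl_head[OF assms] coeffs_trancl_sim by metis
      \<comment> \<open>Both arrows leave \<open>n\<close> and hence coincide, so the lifted chain
        is a cycle at the parent.\<close>
      then show False using 1 unique_out by metis
    qed
  qed
qed

text \<open>Idempotence of the projection: \<open>u n\<close> already lies in \<open>U\<close>, so
  projecting its expansion in basis vectors returns it.\<close>

lemma u_expand:
  assumes n: "n \<in> verts T"
  shows "u n = lin_ext u (u n)"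
proof (rule splitting_unique)
  let ?x = "vmap F n"
  show x: "?x \<in> verts Q" using n vmap_in_verts by blast
  have key: "m \<in> verts T" "vmap F m = ?x" if "m \<in> Poly_Mapping.keys (u n)" for m
    using coeff_in_verts[OF n] that by (auto simp: in_keys_iff)
  show "u n \<in> space U ?x" using u_in n by blast
  show "0 \<in> space W ?x" using subspace_W[OF x] by (rule pm.subspace_0)
  show "lin_ext u (u n) \<in> space U ?x"
    unfolding lin_ext_def using key u_in
    by (intro pm.subspace_sum[OF subspace_U[OF x]] pm.subspace_scale[OF subspace_U[OF x]]) metis
  let ?w = "lin_ext (\<lambda>m. basis_vec m - u m) (u n)"
  show "?w \<in> space W ?x"
    unfolding lin_ext_def using key basis_vec_minus_u_in
    by (intro pm.subspace_sum[OF subspace_W[OF x]] pm.subspace_scale[OF subspace_W[OF x]]) metis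
  have "lin_ext u (u n) + ?w = lin_ext basis_vec (u n)"
    by (simp add: lin_ext_def sum.distrib[symmetric] pm.scale_right_distrib[symmetric])
  then show "u n + 0 = lin_ext u (u n) + ?w" by (simp add: lin_ext_basis_vec_id)
qed

text \<open>By induction along \<open>coeffs\<close>, every term of the expansion in
  \<open>u_expand\<close> vanishes.\<close>

lemma u_eq_0:
  assumes c0: "Poly_Mapping.lookup (u r) r = 0"
  shows "n \<in> verts T \<Longrightarrow> u n = 0"
proof -
  have "coeffs \<subseteq> verts T \<times> verts T" using coeff_in_verts by (auto simp: coeffs_def)
  then have "finite coeffs" by (rule finite_subset) simp
  then have "wf (coeffs\<inverse>)" using acyclic_coeffs[OF c0] by (rule finite_acyclic_wf_converse)
  then show "n \<in> verts T \<Longrightarrow> u n = 0"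
  proof (induction n rule: wf_induct_rule)
    case (less n)
    have "u m = 0" if "m \<in> Poly_Mapping.keys (u n)" for m
      using less coeff_in_verts that by (auto simp: coeffs_def in_keys_iff)
    then show ?case using u_expand[OF less.prems] by (simp add: lin_ext_def)
  qed
qed

text \<open>All basis vectors of the tree lie in \<open>W\<close> once their components in
  \<open>U\<close> vanish, so \<open>U\<close> is contained in \<open>W\<close>.\<close>

lemma U_zero:
  assumes c0: "Poly_Mapping.lookup (u r) r = 0"
  shows "\<not> nonzero_rep Q U"
proof -
  have "f = 0" if x: "x \<in> verts Q" and f: "f \<in> space U x" for x f
  proof (rule inter_zero[OF x f])
    have "basis_vec n \<in> space W x" if "n \<in> Poly_Mapping.keys f" for n
      using keys_space_tree_module[OF space_U_le[OF x f]] that basis_vec_minus_u_in u_eq_0[OF c0] by fastforce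
    then have "lin_ext basis_vec f \<in> space W x"
      unfolding lin_ext_def
      by (intro pm.subspace_sum[OF subspace_W[OF x]] pm.subspace_scale[OF subspace_W[OF x]])
    then show "f \<in> space W x" by (simp add: lin_ext_basis_vec_id)
  qed
  then have "space U x = {0}" if "x \<in> verts Q" for x
    using that pm.subspace_0[OF subspace_U] by blast
  then show ?thesis by (simp add: nonzero_rep_def)
qed

end

section \<open>Trees without similar siblings\<close>

context in_tree begin

lemma not_decomposable_if_no_sim_siblings:
  fixes F :: "('n, 'e, 'v, 'a) quiver_map"
  assumes F: "quiver_morphism T Q F"
    and no_sim: "\<And>a b. a \<in> arcs T \<Longrightarrow> b \<in> arcs T \<Longrightarrow> a \<noteq> b \<Longrightarrow> head T a = head T b \<Longrightarrow>
      amap F a = amap F b \<Longrightarrow> \<not> sim T F (tail T a) (tail T b)"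
  shows "\<not> decomposable Q \<rho> (tree_module T F :: ('v, 'a, 'k::field, 'n \<Rightarrow>\<^sub>0 'k) quiver_rep)"
proof
  assume "decomposable Q \<rho> (tree_module T F :: ('v, 'a, 'k, 'n \<Rightarrow>\<^sub>0 'k) quiver_rep)"
  then obtain U W where UW: "direct_sum_of Q \<rho> (tree_module T F :: ('v, 'a, 'k, 'n \<Rightarrow>\<^sub>0 'k) quiver_rep) U W"
    "nonzero_rep Q U" "nonzero_rep Q W" by (auto simp: decomposable_def)
  interpret UW: tree_splitting T r Q \<rho> F U W
    by unfold_locales (use F UW(1) no_sim in blast)+
  interpret WU: tree_splitting T r Q \<rho> F W U
    by unfold_locales (use F direct_sum_of_commute[OF UW(1)] no_sim in blast)+
  \<comment> \<open>As \<open>U\<close> is nonzero, the root vector has a nonzero component in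
    \<open>U\<close> and thus lies in \<open>U\<close>. Its component in \<open>W\<close> is then
    zero, and \<open>U_zero\<close> for the exchanged splitting gives \<open>W = 0\<close>.\<close>
  have "Poly_Mapping.lookup (UW.u r) r \<noteq> 0" using UW.U_zero UW(2) by blast
  then have "basis_vec r \<in> space U (vmap F r)" by (rule UW.basis_vec_root_in_U)
  then have "WU.u r = 0"
    using root_in_verts WU.subspace_U[THEN pm.subspace_0] UW.vmap_in_verts by (intro WU.u_eqI) auto
  then show False using WU.U_zero UW(3) by simp
qed

end

section \<open>The criterion in terms of the children of the root\<close>

theorem corollary3p5:
  fixes Q :: "('v, 'a) pre_digraph" and \<rho> :: "('v, 'a) path set"
    and T :: "('n, 'e) pre_digraph" and root :: 'n
    and F :: "('n, 'e, 'v, 'a) quiver_map"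
    and ns :: "'n list"
    and M :: "('v, 'a, 'k::field, 'n \<Rightarrow>\<^sub>0 'k) quiver_rep"
    and Mj :: "nat \<Rightarrow> ('v, 'a, 'k, 'n \<Rightarrow>\<^sub>0 'k) quiver_rep"
  assumes "CHAR('k) \<noteq> 2"
    and "bound_quiver TYPE('k) Q \<rho>"
    and "rooted_tree T root"
    and "bound_morphism TYPE('k) T Q \<rho> F"
    and "M = tree_module T F"
    and "distinct ns" and "set ns = {n \<in> verts T - {root}. parent T n = root}"
    and "\<And>j. j < length ns \<Longrightarrow> Mj j = tree_module (branch T (ns ! j)) F"
    and "\<And>j. j < length ns \<Longrightarrow> indecomposable Q \<rho> (Mj j)"
  shows "decomposable Q \<rho> M \<longleftrightarrow>
    (\<exists>i j. i < length ns \<and> j < length ns \<and> i \<noteq> j \<and>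
       amap F (out_arrow T (ns ! i)) = amap F (out_arrow T (ns ! j)) \<and>
       (\<exists>\<iota>. quiver_morphism (branch T (ns ! i)) (branch T (ns ! j)) \<iota> \<and>
            vmap \<iota> (ns ! i) = ns ! j \<and>
            quiver_map_eq_on (branch T (ns ! i)) (quiver_map_comp F \<iota>) F))"
    (is "_ \<longleftrightarrow> ?b")
proof -
  interpret in_tree T root using assms(3) by (rule rooted_tree_imp_in_tree)
  have F: "quiver_morphism T Q F" using assms(4) by (simp add: bound_morphism_def)
  have M: "fd_rep Q \<rho> (tree_module T F :: ('v, 'a, 'k, 'n \<Rightarrow>\<^sub>0 'k) quiver_rep)"
    using assms(2,4) fin_digraph_axioms by (intro fd_rep_tree_module) (auto simp: bound_quiver_def)
  have out: "out_arrow T n \<in> arcs T" "tail T (out_arrow T n) = n" "head T (out_arrow T n) = root"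
    if n: "n \<in> set ns" for n
  proof -
    obtain a where "a \<in> arcs T" "tail T a = n" using out_ex n assms(7) by auto
    then show "out_arrow T n \<in> arcs T" "tail T (out_arrow T n) = n"
      using out_arrow_tail by auto
    show "head T (out_arrow T n) = root" using n assms(7) by (simp add: parent_def)
  qed
  have child: "tail T a \<in> set ns" if "a \<in> arcs T" "head T a = root" for a
    using that out_arrow_tail tail_neq_root by (simp add: assms(7) parent_def)
  show ?thesis
  proof
    assume ?b
    then obtain i j \<iota> where ij: "i < length ns" "j < length ns" "i \<noteq> j"
      "amap F (out_arrow T (ns ! i)) = amap F (out_arrow T (ns ! j))"
      and \<iota>: "quiver_morphism (branch T (ns ! i)) (branch T (ns ! j)) \<iota>" "vmap \<iota> (ns ! i) = ns ! j"
        "quiver_map_eq_on (branch T (ns ! i)) (quiver_map_comp F \<iota>) F" by blast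
    have mem: "ns ! i \<in> set ns" "ns ! j \<in> set ns" using ij by auto
    have neq: "ns ! i \<noteq> ns ! j" using ij assms(6) nth_eq_iff_index_eq by blast
    have "decomposable Q \<rho> (tree_module T F :: ('v, 'a, 'k, 'n \<Rightarrow>\<^sub>0 'k) quiver_rep)"
    proof (rule decomposable_if_sibling_morphism[OF M F])
      show "out_arrow T (ns ! i) \<in> arcs T" "out_arrow T (ns ! j) \<in> arcs T" using out mem by auto
      show "out_arrow T (ns ! i) \<noteq> out_arrow T (ns ! j)" using out(2) mem neq by metis
      show "head T (out_arrow T (ns ! i)) = head T (out_arrow T (ns ! j))" using out(3) mem by simp
      show "amap F (out_arrow T (ns ! i)) = amap F (out_arrow T (ns ! j))" by fact
    qed (use \<iota> out(2) mem in simp_all)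
    then show "decomposable Q \<rho> M" by (simp add: assms(5))
  next
    assume dec: "decomposable Q \<rho> M"
    show ?b
    proof (rule ccontr)
      assume not_b: "\<not> ?b"
      \<comment> \<open>Similar siblings are excluded at every level: among the children of the root
        by the failure of the morphism condition, and lower down by the indecomposability of the
        branches.\<close>
      have "\<not> sim T F (tail T a) (tail T b)"
        if ab: "a \<in> arcs T" "b \<in> arcs T" "a \<noteq> b" "head T a = head T b" "amap F a = amap F b" for a b
      proof
        assume sim: "sim T F (tail T a) (tail T b)"
        show False
        proof (cases "head T a = root")
          case True
          then obtain i j where ij: "i < length ns" "j < length ns" "ns ! i = tail T a" "ns ! j = tail T b"
            using child ab by (metis in_set_conv_nth)
          have "i \<noteq> j" using ij ab unique_out by metis
          \<comment> \<open>Both vertex labels are the tail of the common label of \<open>a\<close>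
            and \<open>b\<close>.\<close>
          have "vmap F (tail T a) = vmap F (tail T b)"
            using F ab unfolding quiver_morphism_def by metis
          then obtain \<iota> where \<iota>: "quiver_morphism (branch T (tail T a)) (branch T (tail T b)) \<iota>"
            "vmap \<iota> (tail T a) = tail T b" "quiver_map_eq_on (branch T (tail T a)) (quiver_map_comp F \<iota>) F"
            using sim_imp_branch_morphism[OF F sim] ab by auto
          have "amap F (out_arrow T (ns ! i)) = amap F (out_arrow T (ns ! j))"
            using ij ab out_arrow_tail by simp
          then show False using \<iota> not_b ij \<open>i \<noteq> j\<close> by metis
        next
          case False
          \<comment> \<open>The siblings lie in the branch at the child \<open>tail T c\<close> of
            the root, and their similarity restricts to that branch and decomposes its
            module.\<close>
          then obtain c where c: "c \<in> arcs T" "head T c = root" "head T a \<rightarrow>\<^sup>*\<^bsub>T\<^esub> tail T c"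
            using reachable_via_tail all_reach_root ab(1) by (metis head_in_verts)
          then obtain j where j: "j < length ns" "ns ! j = tail T c" using child by (metis in_set_conv_nth)
          let ?B = "branch T (tail T c)"
          let ?MB = "tree_module ?B F :: ('v, 'a, 'k, 'n \<Rightarrow>\<^sub>0 'k) quiver_rep"
          interpret B: in_tree ?B "tail T c" using c by (intro in_tree_branch) auto
          have indec: "indecomposable Q \<rho> ?MB" using assms(8,9) j by metis
          have F_B: "quiver_morphism ?B Q F" using F by (rule quiver_morphism_branch)
          have arcs: "a \<in> arcs ?B" "b \<in> arcs ?B" using ab c by (auto simp: arcs_branch)
          have "sim ?B F (tail T a) (tail T b)"
            using sim_branch[OF sim] ab c tail_reachable by simp
          moreover have "vmap F (tail T a) = vmap F (tail T b)"
            using F ab unfolding quiver_morphism_def by metis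
          ultimately obtain \<iota> where \<iota>: "quiver_morphism (branch ?B (tail T a)) (branch ?B (tail T b)) \<iota>"
            "vmap \<iota> (tail T a) = tail T b" "quiver_map_eq_on (branch ?B (tail T a)) (quiver_map_comp F \<iota>) F"
            using B.sim_imp_branch_morphism[OF F_B] B.tail_in_verts arcs by fastforce
          have "decomposable Q \<rho> ?MB"
            by (rule B.decomposable_if_sibling_morphism[OF _ F_B arcs])
              (use indec ab \<iota> in \<open>simp_all add: indecomposable_def\<close>)
          then show False using indec by (simp add: indecomposable_def)
        qed
      qed
      then show False
        using not_decomposable_if_no_sim_siblings[OF F] dec assms(5) by blast
    qed
  qed
qed

end
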